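(* Let $G$ be a finite simple undirected graph with maximum degree $\Delta(G)\le 7$. Then $\tau(G)\le 2\nu(G)$.
   Context: All graphs are finite, simple and undirected. A triangle packing of a graph $G$ is a set of triangles of $G$ that are pairwise edge-disjoint (they may share vertices); $\nu(G)$ is the largest size of a triangle packing of $G$. A triangle transversal of $G$ is a set $Y\subseteq E(G)$ such that $G-Y$ (the graph $G$ with the edges of $Y$ deleted) is triangle-free; $\tau(G)$ is the smallest size of a triangle transversal of $G$. The graph $G$ may be disconnected. *)

theory Defs
  imports Main
begin

text \<open>A graph is a vertex set together with a set of edges, each edge being a two-element set
  of vertices.\<close>

definition simple_graph :: "'a set \<Rightarrow> 'a set set \<Rightarrow> bool" where
  "simple_graph V E \<longleftrightarrow> finite V \<and> (\<forall>e\<in>E. e \<subseteq> V \<and> card e = 2)"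

definition degree :: "'a set set \<Rightarrow> 'a \<Rightarrow> nat" where
  "degree E v = card {e \<in> E. v \<in> e}"

text \<open>The inserted 0 only matters for the graph without vertices, where the library leaves
  \<^const>\<open>Max\<close> of the empty set unspecified.\<close>

definition max_degree :: "'a set \<Rightarrow> 'a set set \<Rightarrow> nat" where
  "max_degree V E = Max (insert 0 (degree E ` V))"

text \<open>A triangle is represented by the set of its three edges, which determines its vertices;
  edge-disjointness of triangles is then disjointness of sets.\<close>

definition triangles :: "'a set set \<Rightarrow> 'a set set set" where
  "triangles E = {{{x, y}, {y, z}, {x, z}} | x y z.
     x \<noteq> y \<and> y \<noteq> z \<and> x \<noteq> z \<and> {x, y} \<in> E \<and> {y, z} \<in> E \<and> {x, z} \<in> E}"

definition triangle_packing :: "'a set set \<Rightarrow> 'a set set set \<Rightarrow> bool" where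
  "triangle_packing E P \<longleftrightarrow> P \<subseteq> triangles E \<and> pairwise disjnt P"

definition packing_number :: "'a set set \<Rightarrow> nat" (\<open>\<nu>\<close>) where
  "\<nu> E = Max {card P | P. triangle_packing E P}"

definition triangle_free :: "'a set set \<Rightarrow> bool" where
  "triangle_free E \<longleftrightarrow> triangles E = {}"

definition triangle_transversal :: "'a set set \<Rightarrow> 'a set set \<Rightarrow> bool" where
  "triangle_transversal E Y \<longleftrightarrow> Y \<subseteq> E \<and> triangle_free (E - Y)"

definition transversal_number :: "'a set set \<Rightarrow> nat" (\<open>\<tau>\<close>) where
  "\<tau> E = Min {card Y | Y. triangle_transversal E Y}"

text \<open>For a finite edge set the two extrema range over finite non-empty sets, hence are
  attained.\<close>

lemma simple_graph_finite_edges: "simple_graph V E \<Longrightarrow> finite E"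
  unfolding simple_graph_def by (rule finite_subset[of E "Pow V"]) auto

lemma packing_number_attained:
  assumes "finite E"
  shows "\<exists>P. triangle_packing E P \<and> card P = \<nu> E"
    and "triangle_packing E Q \<Longrightarrow> card Q \<le> \<nu> E"
proof -
  let ?S = "{card P | P. triangle_packing E P}"
  have "triangles E \<subseteq> Pow E" by (auto simp: triangles_def)
  then have "{P. triangle_packing E P} \<subseteq> Pow (Pow E)" by (auto simp: triangle_packing_def)
  then have "finite {P. triangle_packing E P}" using assms by (simp add: finite_subset)
  then have fin: "finite ?S" by simp
  have "triangle_packing E {}" by (simp add: triangle_packing_def)
  then have "?S \<noteq> {}" by blast
  then have "\<nu> E \<in> ?S" using Max_in[OF fin] by (simp add: packing_number_def)
  then show "\<exists>P. triangle_packing E P \<and> card P = \<nu> E" by auto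
  show "triangle_packing E Q \<Longrightarrow> card Q \<le> \<nu> E"
    unfolding packing_number_def by (rule Max_ge[OF fin]) blast
qed

lemma transversal_number_attained:
  assumes "finite E"
  shows "\<exists>Y. triangle_transversal E Y \<and> card Y = \<tau> E"
    and "triangle_transversal E Z \<Longrightarrow> \<tau> E \<le> card Z"
proof -
  let ?S = "{card Y | Y. triangle_transversal E Y}"
  have "{Y. triangle_transversal E Y} \<subseteq> Pow E" by (auto simp: triangle_transversal_def)
  then have "finite {Y. triangle_transversal E Y}" using assms by (simp add: finite_subset)
  then have fin: "finite ?S" by simp
  have "triangle_transversal E E"
    by (simp add: triangle_transversal_def triangle_free_def triangles_def)
  then have "?S \<noteq> {}" by blast
  then have "\<tau> E \<in> ?S" using Min_in[OF fin] by (simp add: transversal_number_def)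
  then show "\<exists>Y. triangle_transversal E Y \<and> card Y = \<tau> E" by auto
  show "triangle_transversal E Z \<Longrightarrow> \<tau> E \<le> card Z"
    unfolding transversal_number_def by (rule Min_le[OF fin]) blast
qed

end

theory Submission
  imports Defs
begin

text \<open>Let \<open>E\<close> be a smallest counterexample. Call the graph induced on the neighbours of \<open>v\<close> the link
  of \<open>v\<close>. The main reduction takes a matching \<open>M\<close> of the link, adds the triangles spanned by \<open>v\<close>
  and the edges of \<open>M\<close> to a packing of what remains after deleting \<open>v\<close> and \<open>M\<close>, and adds \<open>M\<close>
  together with a set of edges at \<open>v\<close> to an optimal transversal \<open>Y\<close> of the remainder. The edges
  at \<open>v\<close> only have to cover the part of the link avoiding \<open>M\<close> and \<open>Y\<close>, and this part is
  triangle-free. As a triangle-free graph on six vertices has three independent vertices, no vertex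
  has degree 6; smaller degrees are excluded in the same way, except that neighbourhoods close to
  \<open>K\<^sub>5\<close> need larger local configurations. So all degrees are 7, and for every matching of three edges
  in a link the triangle-free remainder has no four independent vertices. Applied at both ends of
  an edge, this forces every edge to lie in at least four triangles. Then every component
  has 8 or 10 vertices (7-regularity makes the order even). Such a component contains six
  edge-disjoint triangles and has a cut missing at most twelve of its edges.\<close>

text \<open>The factor 2 is what a matching edge \<open>ab\<close> of the link pays for: the packed
  triangle on \<open>v\<close>, \<open>a\<close>, \<open>b\<close> buys the edge \<open>ab\<close>
  and one edge at \<open>v\<close>. The remainder \<open>J\<close> of the link depends on a
  transversal \<open>Y\<close> that cannot be controlled, so only three facts are available:
  \<open>J\<close> has no triangle, it avoids the chosen matching, and it inherits every
  non-adjacency of the graph. Each local contradiction is therefore a choice of matching after which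
  too many vertices are independent in \<open>J\<close>, or a triangle of \<open>J\<close> is
  forced. At degree 6 the Ramsey number R(3,3) = 6 settles this at once; at degree 7 four
  independent vertices among seven are wanted, and R(3,4) = 9 is too large. Hence the study of edges
  in few triangles. There the links at both ends of an edge \<open>vw\<close> meet in a common
  neighbour \<open>c\<close>: each link forces \<open>c\<close> to see many vertices private to that
  end, and \<open>c\<close> has only seven places. The bound of four triangles per edge is what
  stops growth: a neighbour of \<open>v\<close> then has at most 7 - 1 - 4 = 2 neighbours at
  distance two from \<open>v\<close>.\<close>

definition tri_edges :: "'a \<times> 'a \<times> 'a \<Rightarrow> 'a set list" where
  "tri_edges t = (case t of (x, y, z) \<Rightarrow> [{x, y}, {y, z}, {x, z}])"

lemma set_tri_edges [simp]: "set (tri_edges (x, y, z)) = {{x, y}, {y, z}, {x, z}}"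
  by (simp add: tri_edges_def)

text \<open>Triangles are kept as edge lists so that edge-disjointness of a concrete family is a
  single \<open>distinct\<close> statement, which simplification settles. Nonempty blocks never
  coincide as sets, so no triangle is lost in the count.\<close>

lemma disjoint_blocks:
  assumes "distinct (concat (map f ts))" and "\<And>t. t \<in> set ts \<Longrightarrow> f t \<noteq> []"
  shows "pairwise disjnt (set (map (set \<circ> f) ts)) \<and> card (set (map (set \<circ> f) ts)) = length ts"
  using assms
proof (induction ts)
  case Nil
  then show ?case by simp
next
  case (Cons t ts)
  let ?A = "set (map (set \<circ> f) ts)"
  have IH: "pairwise disjnt ?A" "card ?A = length ts"
    using Cons by auto
  have dis: "disjnt (set (f t)) B" if "B \<in> ?A" for B
    using that Cons.prems(1) by (auto simp: disjnt_def)
  have "set (f t) \<noteq> {}" using Cons.prems(2) by simp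
  then have "set (f t) \<notin> ?A" using dis by (metis disjnt_self_iff_empty)
  then show ?case using IH dis by (simp add: pairwise_insert disjnt_sym)
qed

lemma distinct_star_triangles:
  assumes "distinct (v # concat (map (\<lambda>(a, b). [a, b]) xs))"
  shows "distinct (concat (map tri_edges (map (\<lambda>(a, b). (v, a, b)) xs)))"
  using assms
proof (induction xs)
  case (Cons p xs)
  obtain a b where p: "p = (a, b)" by (cases p)
  let ?ys = "map (\<lambda>(a, b). (v, a, b)) xs"
  have IH: "distinct (concat (map tri_edges ?ys))"
    using Cons by (simp add: p)
  have dis: "set (tri_edges (v, a, b)) \<inter> set (tri_edges (v, c, d)) = {}" if "(c, d) \<in> set xs" for c d
  proof -
    have "c \<in> set (concat (map (\<lambda>(a, b). [a, b]) xs))" "d \<in> set (concat (map (\<lambda>(a, b). [a, b]) xs))"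
      using that by force+
    then have "a \<noteq> c" "a \<noteq> d" "b \<noteq> c" "b \<noteq> d" "v \<noteq> c" "v \<noteq> d" "v \<noteq> a" "v \<noteq> b"
      using Cons.prems by (auto simp: p)
    then show ?thesis by (auto simp: doubleton_eq_iff)
  qed
  have "set (tri_edges (v, a, b)) \<inter> set (concat (map tri_edges ?ys)) = {}"
  proof (rule ccontr)
    assume "set (tri_edges (v, a, b)) \<inter> set (concat (map tri_edges ?ys)) \<noteq> {}"
    then obtain e q where "e \<in> set (tri_edges (v, a, b))" "q \<in> set xs"
      "e \<in> set (tri_edges (case q of (a, b) \<Rightarrow> (v, a, b)))"
      by auto
    then show False using dis[of "fst q" "snd q"] by (simp only: split_beta) auto
  qed
  moreover have "distinct (tri_edges (v, a, b))"
    using Cons.prems by (auto simp: p tri_edges_def doubleton_eq_iff)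
  ultimately have "distinct (tri_edges (v, a, b) @ concat (map tri_edges ?ys))"
    unfolding distinct_append using IH by blast
  then show ?case by (simp add: p)
qed simp

lemma two_elements:
  assumes "2 \<le> card A"
  obtains x y where "x \<in> A" "y \<in> A" "x \<noteq> y"
proof -
  obtain B where "B \<subseteq> A" "card B = 2" using obtain_subset_with_card_n[OF assms] by blast
  then show thesis using that by (auto simp: card_2_iff)
qed

lemma three_elements:
  assumes "3 \<le> card A"
  obtains x y z where "x \<in> A" "y \<in> A" "z \<in> A" "x \<noteq> y" "x \<noteq> z" "y \<noteq> z"
proof -
  obtain B where "B \<subseteq> A" "card B = 3" using obtain_subset_with_card_n[OF assms] by blast
  then show thesis using that by (auto simp: card_3_iff)
qed

text \<open>A graph is reduced to its edge set here, and \<open>degree_le\<close> speaks of all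
  elements of the type. Minimality is under deletion of edges, the only operation the reductions
  perform.\<close>

locale min_counterexample =
  fixes E :: "'a set set"
  assumes finite_E: "finite E"
    and two_E: "e \<in> E \<Longrightarrow> card e = 2"
    and degree_le: "degree E v \<le> 7"
    and counter: "2 * \<nu> E < \<tau> E"
    and minimal: "F \<subset> E \<Longrightarrow> \<tau> F \<le> 2 * \<nu> F"
begin

subsection \<open>Reducible configurations\<close>

definition adj :: "'a \<Rightarrow> 'a \<Rightarrow> bool" where
  "adj x y \<longleftrightarrow> {x, y} \<in> E"

definition nbrs :: "'a \<Rightarrow> 'a set" where
  "nbrs v = {x. adj v x}"

lemma adj_sym: "adj x y \<longleftrightarrow> adj y x"
  by (simp add: adj_def insert_commute)

lemma adj_irrefl [simp]: "\<not> adj x x"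
  using two_E[of "{x}"] by (auto simp: adj_def)

lemma adj_neq: "adj x y \<Longrightarrow> x \<noteq> y"
  by auto

lemma in_nbrs [simp]: "x \<in> nbrs v \<longleftrightarrow> adj v x"
  by (simp add: nbrs_def)

lemma edge_cases:
  assumes "e \<in> E" "v \<in> e"
  obtains x where "e = {v, x}" "adj v x"
proof -
  obtain a b where "e = {a, b}" using two_E[OF assms(1)] by (auto simp: card_2_iff)
  then show ?thesis using that assms by (auto simp: adj_def insert_commute)
qed

lemma star_eq: "{e \<in> E. v \<in> e} = (\<lambda>x. {v, x}) ` nbrs v"
proof (intro set_eqI iffI)
  fix e assume "e \<in> {e \<in> E. v \<in> e}"
  then obtain x where "e = {v, x}" "adj v x" using edge_cases by blast
  then show "e \<in> (\<lambda>x. {v, x}) ` nbrs v" by simp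
qed (auto simp: adj_def)

lemma card_nbrs: "card (nbrs v) = degree E v"
proof -
  have "inj_on (\<lambda>x. {v, x}) (nbrs v)" by (auto simp: inj_on_def doubleton_eq_iff)
  then show ?thesis unfolding degree_def star_eq by (simp add: card_image)
qed

lemma card_nbrs_le: "card (nbrs v) \<le> 7"
  using degree_le by (simp add: card_nbrs)

lemma finite_nbrs [simp]: "finite (nbrs v)"
proof -
  have "nbrs v \<subseteq> \<Union>E" by (auto simp: adj_def)
  moreover have "finite (\<Union>E)"
    using finite_E two_E by (metis card.infinite finite_Union zero_neq_numeral)
  ultimately show ?thesis by (rule finite_subset)
qed

lemma triangle_free_iff:
  assumes "F \<subseteq> E"
  shows "triangle_free F \<longleftrightarrow> (\<forall>x y z. \<not> ({x, y} \<in> F \<and> {y, z} \<in> F \<and> {x, z} \<in> F))"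
proof -
  have ne: "x \<noteq> y" if "{x, y} \<in> F" for x y
    using that assms adj_neq[of x y] unfolding adj_def by blast
  have "triangles F \<noteq> {} \<longleftrightarrow> (\<exists>x y z. x \<noteq> y \<and> y \<noteq> z \<and> x \<noteq> z \<and> {x, y} \<in> F \<and> {y, z} \<in> F \<and> {x, z} \<in> F)"
    unfolding triangles_def by blast
  then show ?thesis using ne unfolding triangle_free_def by blast
qed

lemma transversal_iff:
  assumes "F \<subseteq> E"
  shows "triangle_transversal F X \<longleftrightarrow> X \<subseteq> F \<and>
    (\<forall>x y z. {x, y} \<in> F \<and> {y, z} \<in> F \<and> {x, z} \<in> F \<longrightarrow> {x, y} \<in> X \<or> {y, z} \<in> X \<or> {x, z} \<in> X)"
proof -
  have "F - X \<subseteq> E" using assms by blast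
  from triangle_free_iff[OF this] show ?thesis
    unfolding triangle_transversal_def by blast
qed

text \<open>\<open>T\<close> extends every packing of \<open>E - D\<close>, so restoring
  \<open>D\<close> raises \<open>\<nu>\<close> by at least \<open>card T\<close>, while
  \<open>cover\<close> bounds the rise of \<open>\<tau>\<close> by twice that; minimality for
  \<open>E - D\<close> then contradicts \<open>counter\<close>. \<open>D\<close> may contain more
  than the edges of \<open>T\<close>.\<close>

lemma reduction:
  assumes T: "triangle_packing E T" "\<Union>T \<subseteq> D" and D: "D \<subseteq> E" "D \<noteq> {}"
    and cover: "\<And>Y. triangle_transversal (E - D) Y \<Longrightarrow>
      \<exists>S. S \<subseteq> E \<and> card S \<le> 2 * card T \<and> triangle_transversal E (S \<union> Y)"
  shows False
proof -
  have fin: "finite (E - D)" using finite_E by simp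
  obtain P where P: "triangle_packing (E - D) P" "card P = \<nu> (E - D)"
    using packing_number_attained(1)[OF fin] by blast
  obtain Y where Y: "triangle_transversal (E - D) Y" "card Y = \<tau> (E - D)"
    using transversal_number_attained(1)[OF fin] by blast
  obtain S where S: "S \<subseteq> E" "card S \<le> 2 * card T" "triangle_transversal E (S \<union> Y)"
    using cover[OF Y(1)] by blast
  have tri: "triangles (E - D) \<subseteq> triangles E"
    unfolding triangles_def by blast
  have PD: "p \<subseteq> E - D" if "p \<in> P" for p
    using that P(1) by (auto simp: triangle_packing_def triangles_def)
  have ne: "p \<noteq> {}" if "p \<in> P" for p
    using that P(1) by (auto simp: triangle_packing_def triangles_def)
  have dis: "disjnt p t" if "p \<in> P" "t \<in> T" for p t
    using PD[OF that(1)] that(2) T(2) by (auto simp: disjnt_def)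
  have pack: "triangle_packing E (T \<union> P)"
    using T(1) P(1) tri dis unfolding triangle_packing_def
    by (auto simp: pairwise_def disjnt_sym)
  have "T \<inter> P = {}" using dis ne by (metis disjoint_iff disjnt_self_iff_empty)
  moreover have "finite T" "finite P"
  proof -
    have "triangles E \<subseteq> Pow E" by (auto simp: triangles_def)
    then have "finite (triangles E)" using finite_E by (simp add: finite_subset)
    then show "finite T" "finite P"
      using pack by (auto simp: triangle_packing_def intro: finite_subset)
  qed
  ultimately have "card T + card P \<le> \<nu> E"
    using packing_number_attained(2)[OF finite_E pack] by (simp add: card_Un_disjoint)
  moreover have "\<tau> E \<le> card S + card Y"
    using transversal_number_attained(2)[OF finite_E S(3)] card_Un_le[of S Y] by linarith
  moreover have "\<tau> (E - D) \<le> 2 * \<nu> (E - D)"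
    using D by (intro minimal) auto
  ultimately show False using counter S(2) P(2) Y(2) by linarith
qed

lemma packing_list:
  assumes "distinct (concat (map tri_edges ts))"
    and "\<And>x y z. (x, y, z) \<in> set ts \<Longrightarrow> adj x y \<and> adj y z \<and> adj x z"
  shows "triangle_packing E (set (map (set \<circ> tri_edges) ts))"
    and "card (set (map (set \<circ> tri_edges) ts)) = length ts"
proof -
  have ne: "tri_edges t \<noteq> []" for t :: "'a \<times> 'a \<times> 'a"
    by (auto simp: tri_edges_def split: prod.split)
  note * = disjoint_blocks[of tri_edges, OF assms(1) ne]
  show "card (set (map (set \<circ> tri_edges) ts)) = length ts" using * by blast
  have "set (tri_edges t) \<in> triangles E" if t: "t \<in> set ts" for t
  proof -
    obtain x y z where [simp]: "t = (x, y, z)" by (cases t)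
    have "adj x y" "adj y z" "adj x z" using assms(2) t by auto
    moreover from this have "x \<noteq> y" "y \<noteq> z" "x \<noteq> z" by auto
    ultimately show ?thesis unfolding triangles_def adj_def by auto
  qed
  then show "triangle_packing E (set (map (set \<circ> tri_edges) ts))"
    using * by (auto simp: triangle_packing_def)
qed

definition covered :: "'a set set \<Rightarrow> 'a \<Rightarrow> 'a \<Rightarrow> bool" where
  "covered S x y \<longleftrightarrow> (\<forall>z. adj x z \<longrightarrow> adj y z \<longrightarrow> {x, y} \<in> S \<or> {x, z} \<in> S \<or> {y, z} \<in> S)"

lemma covered_sym: "covered S x y \<longleftrightarrow> covered S y x"
  unfolding covered_def by (auto simp: insert_commute)

text \<open>Here \<open>D\<close> consists of the edges of the packed triangles only. A triangle
  using one of them is hit by \<open>S\<close> through \<open>covered\<close>; any other triangle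
  survives in \<open>E - D\<close> and is hit by the transversal there. So \<open>S\<close> can be
  checked locally, without reference to \<open>Y\<close>.\<close>

lemma local_reduction:
  assumes "ts \<noteq> []" and dist: "distinct (concat (map tri_edges ts))"
    and tri: "\<And>x y z. (x, y, z) \<in> set ts \<Longrightarrow> adj x y \<and> adj y z \<and> adj x z"
    and card: "card S \<le> 2 * length ts" and fin: "finite S"
    and cov: "\<And>x y z. (x, y, z) \<in> set ts \<Longrightarrow> covered S x y \<and> covered S y z \<and> covered S x z"
  shows False
proof (rule reduction)
  let ?T = "set (map (set \<circ> tri_edges) ts)"
  show "triangle_packing E ?T" using packing_list(1)[OF dist tri] by blast
  show "\<Union>?T \<subseteq> \<Union>?T" by simp
  have "set (tri_edges t) \<subseteq> E" if "t \<in> set ts" for t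
    using tri[of "fst t" "fst (snd t)" "snd (snd t)"] that by (simp add: tri_edges_def adj_def split_beta)
  then show "\<Union>?T \<subseteq> E" by auto
  have "hd (tri_edges (hd ts)) \<in> \<Union>?T" using assms(1)
    by (cases ts) (simp_all add: tri_edges_def split_beta)
  then show "\<Union>?T \<noteq> {}" by blast
  fix Y assume Y: "triangle_transversal (E - \<Union>?T) Y"
  \<comment> \<open>\<open>S\<close> may contain pairs that are not edges; intersecting with
    \<open>E\<close> only makes it smaller.\<close>
  have "triangle_transversal E (S \<inter> E \<union> Y)"
    unfolding transversal_iff[OF subset_refl]
  proof (intro conjI allI impI)
    show "S \<inter> E \<union> Y \<subseteq> E" using Y by (auto simp: triangle_transversal_def)
    fix x y z assume a: "{x, y} \<in> E \<and> {y, z} \<in> E \<and> {x, z} \<in> E"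
    show "{x, y} \<in> S \<inter> E \<union> Y \<or> {y, z} \<in> S \<inter> E \<union> Y \<or> {x, z} \<in> S \<inter> E \<union> Y"
    proof (cases "{x, y} \<in> \<Union>?T \<or> {y, z} \<in> \<Union>?T \<or> {x, z} \<in> \<Union>?T")
      case True
      have U: "\<Union>?T = set (concat (map tri_edges ts))" by simp
      have adj: "adj x y" "adj y z" "adj x z" "adj y x" "adj z y" "adj z x"
        using a by (simp_all add: adj_def insert_commute)
      have comm: "{y, x} = {x, y}" "{z, x} = {x, z}" "{z, y} = {y, z}" by auto
      have hit: "{x, y} \<in> S \<or> {x, z} \<in> S \<or> {y, z} \<in> S"
        if xy: "{x, y} \<in> set (concat (map tri_edges ts))" and "adj x z" "adj y z" for x y z
      proof -
        obtain p q r where "(p, q, r) \<in> set ts" "{x, y} \<in> {{p, q}, {q, r}, {p, r}}"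
          using xy by (auto simp: tri_edges_def split_beta)
        then have "covered S x y"
          using cov[of p q r] covered_sym by (auto simp: doubleton_eq_iff)
        then show ?thesis using that unfolding covered_def by blast
      qed
      have "{x, y} \<in> S \<or> {y, z} \<in> S \<or> {x, z} \<in> S"
        using True hit[of x y z] hit[of y z x] hit[of x z y] adj unfolding U comm by argo
      then show ?thesis using a by blast
    next
      case False
      then show ?thesis using Y a transversal_iff[of "E - \<Union>?T" Y] by blast
    qed
  qed
  moreover have "card (S \<inter> E) \<le> 2 * card ?T"
  proof -
    have "card (S \<inter> E) \<le> card S" using fin by (intro card_mono) auto
    then show ?thesis using card packing_list(2)[OF dist tri] by simp
  qed
  ultimately show "\<exists>S. S \<subseteq> E \<and> card S \<le> 2 * card ?T \<and> triangle_transversal E (S \<union> Y)"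
    by (intro exI[of _ "S \<inter> E"]) simp
qed

section \<open>Reduction at a vertex by a matching of its link\<close>

definition link_graph :: "'a \<Rightarrow> ('a \<Rightarrow> 'a \<Rightarrow> bool) \<Rightarrow> bool" where
  "link_graph v J \<longleftrightarrow> (\<forall>x y. J x y \<longrightarrow> adj v x \<and> adj v y \<and> adj x y \<and> J y x) \<and>
    (\<forall>x y z. \<not> (J x y \<and> J y z \<and> J x z))"

lemma link_graphD:
  assumes "link_graph v J"
  shows "J x y \<Longrightarrow> adj x y" "J x y \<Longrightarrow> J y x" "\<not> J x x" "J x y \<Longrightarrow> J y z \<Longrightarrow> \<not> J x z"
  using assms adj_irrefl unfolding link_graph_def by blast+

text \<open>Here \<open>J\<close> is the link without the matching \<open>xs\<close> and without an optimal transversal of the graph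
  left after deleting \<open>v\<close> and \<open>xs\<close>.\<close>

lemma link_matching:
  assumes "xs \<noteq> []" and dist: "distinct (concat (map (\<lambda>(a, b). [a, b]) xs))"
    and tri: "\<And>a b. (a, b) \<in> set xs \<Longrightarrow> adj v a \<and> adj v b \<and> adj a b"
  shows "\<exists>J. link_graph v J \<and> (\<forall>(a, b)\<in>set xs. \<not> J a b) \<and>
    (\<forall>I. I \<subseteq> nbrs v \<longrightarrow> card (nbrs v) \<le> card I + length xs \<longrightarrow> (\<exists>x\<in>I. \<exists>y\<in>I. J x y))"
proof (rule ccontr)
  assume "\<not> ?thesis"
  then have no_J: "\<not> (link_graph v J \<and> (\<forall>(a, b)\<in>set xs. \<not> J a b) \<and>
    (\<forall>I. I \<subseteq> nbrs v \<longrightarrow> card (nbrs v) \<le> card I + length xs \<longrightarrow> (\<exists>x\<in>I. \<exists>y\<in>I. J x y)))" for J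
    unfolding not_ex by (rule spec)
  define ts where "ts = map (\<lambda>(a, b). (v, a, b)) xs"
  define M where "M = (\<lambda>(a, b). {a, b}) ` set xs"
  define D where "D = {e \<in> E. v \<in> e} \<union> M"
  let ?T = "set (map (set \<circ> tri_edges) ts)"
  have v: "v \<notin> set (concat (map (\<lambda>(a, b). [a, b]) xs))"
    using tri by fastforce
  have dts: "distinct (concat (map tri_edges ts))"
    unfolding ts_def using v dist by (intro distinct_star_triangles) simp
  have adjts: "adj x y \<and> adj y z \<and> adj x z" if "(x, y, z) \<in> set ts" for x y z
    using that tri by (auto simp: ts_def)
  have ME: "M \<subseteq> E" using tri by (auto simp: M_def adj_def)
  show False
  proof (rule reduction)
    show "triangle_packing E ?T" using packing_list(1)[OF dts adjts] by blast
    show "\<Union>?T \<subseteq> D"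
    proof
      fix e assume "e \<in> \<Union>?T"
      then obtain a b where "(a, b) \<in> set xs" "e \<in> {{v, a}, {a, b}, {v, b}}"
        by (auto simp: ts_def)
      then show "e \<in> D" using tri by (auto simp: D_def M_def adj_def)
    qed
    show "D \<subseteq> E" using ME by (auto simp: D_def)
    show "D \<noteq> {}" using assms(1) by (cases xs) (auto simp: D_def M_def)
    fix Y assume Y: "triangle_transversal (E - D) Y"
    define J where "J x y \<longleftrightarrow> adj v x \<and> adj v y \<and> {x, y} \<in> E - D - Y" for x y
    have YD: "E - D \<subseteq> E" by blast
    have hitY: "{x, y} \<in> Y \<or> {y, z} \<in> Y \<or> {x, z} \<in> Y"
      if "{x, y} \<in> E - D" "{y, z} \<in> E - D" "{x, z} \<in> E - D" for x y z
      using Y that unfolding transversal_iff[OF YD] by blast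
    have J: "link_graph v J"
      unfolding link_graph_def
    proof (intro conjI allI impI)
      fix x y assume "J x y"
      then show "adj v x" "adj v y" "adj x y" "J y x"
        by (simp_all add: J_def adj_def insert_commute)
    next
      fix x y z show "\<not> (J x y \<and> J y z \<and> J x z)"
        using hitY[of x y z] unfolding J_def by blast
    qed
    have "\<forall>(a, b)\<in>set xs. \<not> J a b"
      by (auto simp: J_def D_def M_def)
    then obtain I where I: "I \<subseteq> nbrs v" "card (nbrs v) \<le> card I + length xs"
      "\<not> (\<exists>x\<in>I. \<exists>y\<in>I. J x y)"
      using no_J[of J] J by blast
    \<comment> \<open>\<open>K\<close> is a vertex cover of \<open>J\<close> no larger than the
      matching. The edges from \<open>v\<close> to \<open>K\<close> hit every triangle at
      \<open>v\<close> that neither \<open>M\<close> nor \<open>Y\<close> hits.\<close>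
    define K where "K = nbrs v - I"
    have "card K = card (nbrs v) - card I"
      using I(1) by (simp add: K_def card_Diff_subset finite_subset)
    then have K: "finite K" "card K \<le> length xs" "\<And>x y. J x y \<Longrightarrow> x \<in> K \<or> y \<in> K"
      using I by (auto simp: K_def J_def)
    define S where "S = M \<union> (\<lambda>x. {v, x}) ` (K \<inter> nbrs v)"
    have "card M \<le> length xs" unfolding M_def
      by (meson card_image_le card_length finite_set le_trans)
    moreover have "card ((\<lambda>x. {v, x}) ` (K \<inter> nbrs v)) \<le> card K"
      using K(1) by (meson card_image_le card_mono finite_Int inf_le1 le_trans)
    moreover have "card S \<le> card M + card ((\<lambda>x. {v, x}) ` (K \<inter> nbrs v))"
      unfolding S_def by (rule card_Un_le)
    moreover have "card ?T = length xs"
      using packing_list(2)[OF dts adjts] by (simp add: ts_def)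
    ultimately have "card S \<le> 2 * card ?T" using K(2) by linarith
    moreover have SE: "S \<subseteq> E" using ME by (auto simp: S_def adj_def)
    moreover have "triangle_transversal E (S \<union> Y)"
      unfolding transversal_iff[OF subset_refl]
    proof (intro conjI allI impI)
      show "S \<union> Y \<subseteq> E" using Y SE by (auto simp: triangle_transversal_def)
      have star: "{v, x} \<in> S \<or> {v, y} \<in> S \<or> {x, y} \<in> S \<union> Y"
        if "{v, x} \<in> E" "{v, y} \<in> E" "{x, y} \<in> E" for x y
      proof (cases "J x y")
        case True
        then have "x \<in> K \<or> y \<in> K" by (rule K(3))
        moreover have "x \<in> nbrs v" "y \<in> nbrs v" using that by (simp_all add: adj_def)
        ultimately show ?thesis unfolding S_def by blast
      next
        case False
        have "v \<noteq> x" "v \<noteq> y" using that adj_neq by (auto simp: adj_def)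
        then have "{x, y} \<in> M \<or> {x, y} \<in> Y"
          using False that unfolding J_def adj_def D_def by blast
        then show ?thesis unfolding S_def by blast
      qed
      fix x y z assume a: "{x, y} \<in> E \<and> {y, z} \<in> E \<and> {x, z} \<in> E"
      have comm: "{y, x} = {x, y}" "{z, x} = {x, z}" "{z, y} = {y, z}" by auto
      show "{x, y} \<in> S \<union> Y \<or> {y, z} \<in> S \<union> Y \<or> {x, z} \<in> S \<union> Y"
      proof (cases "v \<in> {x, y, z}")
        case True
        then consider "v = x" | "v = y" | "v = z" by blast
        then show ?thesis
          using star[of y z] star[of x z] star[of x y] a comm by cases auto
      next
        case False
        show ?thesis
        proof (cases "{x, y} \<in> M \<or> {y, z} \<in> M \<or> {x, z} \<in> M")
          case True
          then show ?thesis by (auto simp: S_def)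
        next
          case F: False
          then have "{x, y} \<in> E - D" "{y, z} \<in> E - D" "{x, z} \<in> E - D"
            using False a by (auto simp: D_def)
          then show ?thesis using hitY by blast
        qed
      qed
    qed
    ultimately show "\<exists>S. S \<subseteq> E \<and> card S \<le> 2 * card ?T \<and> triangle_transversal E (S \<union> Y)"
      by blast
  qed
qed

text \<open>An edge in no triangle can be deleted outright, with empty packing and empty
  \<open>S\<close>. If \<open>c\<close> completes the only triangle on \<open>vw\<close>, pack that
  triangle and pay with \<open>vc\<close> and \<open>wc\<close>: every triangle sharing an edge with
  it contains one of these two.\<close>

lemma codegree_ge_2:
  assumes "adj v w"
  shows "2 \<le> card (nbrs v \<inter> nbrs w)"
proof (rule ccontr)
  let ?C = "nbrs v \<inter> nbrs w"
  assume "\<not> 2 \<le> card ?C"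
  then consider "card ?C = 0" | "card ?C = 1" by linarith
  then show False
  proof cases
    case 1
    then have C: "\<not> (adj v x \<and> adj w x)" for x by auto
    show False
    proof (rule reduction[of "{}" "{{v, w}}"])
      fix Y assume Y: "triangle_transversal (E - {{v, w}}) Y"
      have "triangle_transversal E Y" unfolding transversal_iff[OF subset_refl]
      proof (intro conjI allI impI)
        show "Y \<subseteq> E" using Y by (auto simp: triangle_transversal_def)
        fix x y z assume a: "{x, y} \<in> E \<and> {y, z} \<in> E \<and> {x, z} \<in> E"
        have "{x, y} \<noteq> {v, w}" "{y, z} \<noteq> {v, w}" "{x, z} \<noteq> {v, w}"
          using a C[of z] C[of x] C[of y] by (auto simp: adj_def doubleton_eq_iff insert_commute)
        then show "{x, y} \<in> Y \<or> {y, z} \<in> Y \<or> {x, z} \<in> Y"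
          using a Y transversal_iff[of "E - {{v, w}}" Y] by blast
      qed
      then show "\<exists>S\<subseteq>E. card S \<le> 2 * card {} \<and> triangle_transversal E (S \<union> Y)"
        by (intro exI[of _ "{}"]) simp
    qed (use assms in \<open>auto simp: triangle_packing_def adj_def\<close>)
  next
    case 2
    then obtain c where "?C = {c}" by (auto simp: card_1_singleton_iff)
    then have "x \<in> ?C \<longleftrightarrow> x = c" for x by simp
    then have c: "adj v c" "adj w c" "adj v x \<Longrightarrow> adj w x \<Longrightarrow> x = c" for x
      unfolding Int_iff in_nbrs by blast+
    have ne: "v \<noteq> w" "w \<noteq> c" "v \<noteq> c" using adj_neq assms c(1,2) by blast+
    let ?S = "{{v, c}, {w, c}}"
    have cov: "covered ?S v w" "covered ?S w c" "covered ?S v c"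
      unfolding covered_def using c(3) by (auto dest: adj_sym[THEN iffD1])
    have "distinct (concat (map tri_edges [(v, w, c)]))"
      using ne by (auto simp: tri_edges_def doubleton_eq_iff)
    moreover have "card ?S \<le> 2 * length [(v, w, c)]" by (simp add: card_insert_if)
    ultimately show False
      using local_reduction[of "[(v, w, c)]" ?S] assms c(1,2) cov by auto
  qed
qed

subsection \<open>Matchings in links\<close>

lemma two_common_nbrs:
  assumes "adj v x"
  obtains y z where "y \<noteq> z" "adj v y" "adj v z" "adj x y" "adj x z"
proof -
  have "2 \<le> card (nbrs v \<inter> nbrs x)" using codegree_ge_2[OF assms] .
  then obtain y z where "y \<in> nbrs v \<inter> nbrs x" "z \<in> nbrs v \<inter> nbrs x" "y \<noteq> z"
    by (rule two_elements)
  then show thesis using that by auto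
qed

text \<open>The link has minimum degree two by \<open>two_common_nbrs\<close>. If no edge disjoint
  from \<open>xy\<close> leaves \<open>z\<close> or \<open>z'\<close>, both are joined to
  \<open>x\<close> and to \<open>y\<close>, and \<open>xz\<close>, \<open>yz'\<close> serve
  instead.\<close>

lemma link_2_matching:
  assumes "4 \<le> card (nbrs v)"
  obtains a b c d where "distinct [a, b, c, d]" "{a, b, c, d} \<subseteq> nbrs v" "adj a b" "adj c d"
proof -
  have "nbrs v \<noteq> {}" using assms by auto
  then obtain x where x: "adj v x" by auto
  obtain y where y: "adj v y" "adj x y" using two_common_nbrs[OF x] by metis
  have xy: "x \<noteq> y" using y adj_neq by blast
  have "2 \<le> card (nbrs v - {x, y})" using assms xy x y by (simp add: card_Diff_subset)
  then obtain z z' where z: "z \<in> nbrs v - {x, y}" "z' \<in> nbrs v - {x, y}" "z \<noteq> z'"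
    by (rule two_elements)
  show thesis
  proof (cases "\<exists>s\<in>{z, z'}. \<exists>u\<in>nbrs v - {x, y}. adj s u")
    case True
    then obtain s u where "s \<in> nbrs v - {x, y}" "u \<in> nbrs v - {x, y}" "adj s u"
      using z by blast
    then show thesis using that[of x y s u] x y xy adj_neq by auto
  next
    case False
    have "adj s x \<and> adj s y" if "s \<in> {z, z'}" for s
    proof -
      have "adj v s" using z that by auto
      then obtain p q where "p \<noteq> q" "adj v p" "adj v q" "adj s p" "adj s q"
        using two_common_nbrs by blast
      moreover from this have "p \<in> {x, y}" "q \<in> {x, y}" using False that by auto
      ultimately show ?thesis by auto
    qed
    then show thesis using that[of x z y z'] x y xy z adj_sym by auto
  qed
qed

text \<open>Minimum degree two does not suffice on six vertices, as two disjoint triangles and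
  K(2,4) show. An unmatched vertex sees both ends of one edge of a 2-matching or one end of each;
  the two cases lead to these kinds of links, where two vertices cover everything outside the
  2-matching, against \<open>link_matching\<close>.\<close>

lemma link_3_matching:
  assumes card: "6 \<le> card (nbrs v)"
  obtains a b c d e f where "distinct [a, b, c, d, e, f]" "{a, b, c, d, e, f} \<subseteq> nbrs v"
    "adj a b" "adj c d" "adj e f"
proof (rule ccontr)
  note * = that
  assume no: "\<not> thesis"
  have nm: False if "distinct [a, b, c, d, e, f]" "{a, b, c, d, e, f} \<subseteq> nbrs v"
    "adj a b" "adj c d" "adj e f" for a b c d e f
  proof -
    have thesis using that by (rule *)
    with no show False by contradiction
  qed
  define good where "good a b c d \<longleftrightarrow> distinct [a, b, c, d] \<and> {a, b, c, d} \<subseteq> nbrs v \<and> adj a b \<and> adj c d"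
    for a b c d
  have indep: "\<not> adj u w" if "good a b c d" "u \<in> nbrs v - {a, b, c, d}" "w \<in> nbrs v - {a, b, c, d}" for a b c d u w
    using nm[of a b c d u w] that adj_neq unfolding good_def by auto
  \<comment> \<open>The path \<open>u a b w\<close> would be augmenting.\<close>
  have aug: "\<not> (adj u a \<and> adj w b)" if "good a b c d" "u \<in> nbrs v - {a, b, c, d}"
    "w \<in> nbrs v - {a, b, c, d}" "u \<noteq> w" for a b c d u w
    using nm[of u a w b c d] that unfolding good_def by auto
  have two: "\<exists>p q. p \<noteq> q \<and> {p, q} \<subseteq> {a, b, c, d} \<and> adj u p \<and> adj u q"
    if "good a b c d" "u \<in> nbrs v - {a, b, c, d}" for a b c d u
  proof -
    have "adj v u" using that by auto
    then obtain p q where pq: "p \<noteq> q" "adj v p" "adj v q" "adj u p" "adj u q"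
      using two_common_nbrs by blast
    then have "p \<in> {a, b, c, d}" "q \<in> {a, b, c, d}" using indep[OF that] by auto
    then show ?thesis using pq by auto
  qed
  have sym: "good c d a b" "good b a c d" "good a b d c" if "good a b c d" for a b c d
    using that adj_sym unfolding good_def by auto
  have other: "\<exists>w. w \<in> nbrs v - {a, b, c, d} \<and> w \<noteq> u" if "good a b c d" for a b c d u
  proof -
    have "card (insert u {a, b, c, d}) \<le> 5" by (simp add: card_insert_if)
    then have "\<not> nbrs v \<subseteq> insert u {a, b, c, d}"
      using card card_mono[of "insert u {a, b, c, d}" "nbrs v"] by auto
    then show ?thesis by auto
  qed
  have obtain_J: "\<exists>J. link_graph v J \<and> \<not> J a b \<and> \<not> J c d \<and>
      (\<forall>I. I \<subseteq> nbrs v \<longrightarrow> card (nbrs v) \<le> card I + 2 \<longrightarrow> (\<exists>x\<in>I. \<exists>y\<in>I. J x y))"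
    if "good a b c d" for a b c d
    using link_matching[of "[(a, b), (c, d)]" v] that by (auto simp: good_def)
  \<comment> \<open>Here \<open>w\<close> is the only other unmatched vertex and no edge joins
    \<open>{a, b}\<close> to \<open>{c, d}\<close>, so \<open>u\<close> and \<open>w\<close> cover
    the link apart from the matching edges.\<close>
  have A: False if g: "good a b c d" and u: "u \<in> nbrs v - {a, b, c, d}" "adj u a" "adj u b" for a b c d u
  proof -
    obtain w where w: "w \<in> nbrs v - {a, b, c, d}" "w \<noteq> u" using other[OF g] by blast
    have "\<not> adj x a" "\<not> adj x b" if "x \<in> nbrs v - {a, b, c, d}" "x \<noteq> u" for x
      using aug[OF g u(1) that(1)] aug[OF sym(2)[OF g], of u x] that u by auto
    then have only: "adj x c \<and> adj x d" if "x \<in> nbrs v - {a, b, c, d}" "x \<noteq> u" for x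
      using two[OF g that(1)] that by auto
    have uniq: "x = w" if x: "x \<in> nbrs v - {a, b, c, d}" "x \<noteq> u" for x
      using aug[OF sym(1)[OF g], of x w] only[OF x] only[OF w] x w by auto
    have abcd: "{a, b, c, d} \<subseteq> nbrs v" using g by (simp add: good_def)
    have N: "nbrs v = {a, b, c, d, u, w}" using abcd uniq u(1) w(1) by blast
    have dist: "distinct [a, b, c, d, u, w]" using g u w by (auto simp: good_def)
    have flip: "adj b u" "adj a u" "adj d w" "adj c w"
      using u(2,3) only[OF w] adj_sym by blast+
    have perm: "distinct [a, c, b, u, d, w]" "distinct [a, d, b, u, c, w]"
      "distinct [b, c, a, u, d, w]" "distinct [b, d, a, u, c, w]"
      using dist by auto
    have nadj: "\<not> adj a c" "\<not> adj a d" "\<not> adj b c" "\<not> adj b d"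
      using nm[OF perm(1)] nm[OF perm(2)] nm[OF perm(3)] nm[OF perm(4)] N flip by blast+
    obtain J where J: "link_graph v J" "\<not> J a b" "\<not> J c d"
      "\<And>I. I \<subseteq> nbrs v \<Longrightarrow> card (nbrs v) \<le> card I + 2 \<Longrightarrow> \<exists>x\<in>I. \<exists>y\<in>I. J x y"
      using obtain_J[OF g] by blast
    have "\<exists>x\<in>{a, b, c, d}. \<exists>y\<in>{a, b, c, d}. J x y" using dist N by (intro J(4)) auto
    then show False using nadj J(2,3) link_graphD[OF J(1)] by blast
  qed
  \<comment> \<open>Here all unmatched vertices see \<open>a\<close> and \<open>c\<close> only, and
    \<open>b\<close>, \<open>d\<close> are not adjacent, so \<open>a\<close> and \<open>c\<close>
    cover the link.\<close>
  have B: False if g: "good a b c d" and u: "u \<in> nbrs v - {a, b, c, d}" "adj u a" "adj u c" for a b c d u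
  proof -
    let ?U = "nbrs v - {a, b, c, d}"
    have dist: "distinct [a, b, c, d]" and abcd: "{a, b, c, d} \<subseteq> nbrs v"
      using g by (simp_all add: good_def)
    obtain w where w: "w \<in> ?U" "w \<noteq> u" using other[OF g] by blast
    have notA: "\<not> (adj x a \<and> adj x b)" "\<not> (adj x c \<and> adj x d)" if "x \<in> ?U" for x
      using A[OF g that] A[OF sym(1)[OF g], of x] that by blast+
    have nb: "\<not> adj x b" "\<not> adj x d" if "x \<in> ?U" for x
    proof -
      have "u \<in> nbrs v - {c, d, a, b}" "x \<in> nbrs v - {c, d, a, b}" using u(1) that by auto
      from aug[OF sym(1)[OF g] this] aug[OF g u(1) that] notA[OF u(1)] u(2,3)
      show "\<not> adj x b" "\<not> adj x d" by (cases "x = u"; simp)+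
    qed
    have "adj w a" "adj w c" using two[OF g w(1)] nb[OF w(1)] by auto
    then have "\<not> adj b d" using nm[of b d u a w c] dist abcd u w by auto
    obtain J where J: "link_graph v J" "\<not> J a b" "\<not> J c d"
      "\<And>I. I \<subseteq> nbrs v \<Longrightarrow> card (nbrs v) \<le> card I + 2 \<Longrightarrow> \<exists>x\<in>I. \<exists>y\<in>I. J x y"
      using obtain_J[OF g] by blast
    have "card (nbrs v) = card (nbrs v - {a, c}) + 2"
      using dist abcd card by (simp add: card_Diff_subset)
    then have "\<exists>x\<in>nbrs v - {a, c}. \<exists>y\<in>nbrs v - {a, c}. J x y" by (intro J(4)) auto
    then obtain x y where xy: "x \<in> nbrs v - {a, c}" "y \<in> nbrs v - {a, c}" "adj x y"
      using link_graphD(1)[OF J(1)] by blast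
    have "adj y x" using xy(3) adj_sym by blast
    have "\<not> adj d b" using \<open>\<not> adj b d\<close> adj_sym by blast
    consider "x \<in> ?U" "y \<in> ?U" | "x \<in> ?U" "y \<in> {b, d}" | "y \<in> ?U" "x \<in> {b, d}" | "x \<in> {b, d}" "y \<in> {b, d}"
      using xy by blast
    then show False
    proof cases
      case 1
      then show False using indep[OF g] xy(3) by blast
    next
      case 2
      then show False using nb xy(3) by blast
    next
      case 3
      then show False using nb \<open>adj y x\<close> by blast
    next
      case 4
      then show False using xy(3) \<open>\<not> adj b d\<close> \<open>\<not> adj d b\<close> adj_irrefl by blast
    qed
  qed
  have "4 \<le> card (nbrs v)" using card by simp
  then obtain a b c d where "distinct [a, b, c, d]" "{a, b, c, d} \<subseteq> nbrs v" "adj a b" "adj c d"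
    by (rule link_2_matching)
  then have g: "good a b c d" by (simp add: good_def)
  obtain u where u: "u \<in> nbrs v - {a, b, c, d}" using other[OF g] by blast
  have u': "u \<in> nbrs v - {c, d, a, b}" "u \<in> nbrs v - {b, a, c, d}" "u \<in> nbrs v - {a, b, d, c}"
    "u \<in> nbrs v - {b, a, d, c}" using u by auto
  have "\<not> (adj u a \<and> adj u b)" "\<not> (adj u c \<and> adj u d)" "\<not> (adj u a \<and> adj u c)"
    "\<not> (adj u b \<and> adj u c)" "\<not> (adj u a \<and> adj u d)" "\<not> (adj u b \<and> adj u d)"
    using A[OF g u] A[OF sym(1)[OF g] u'(1)] B[OF g u] B[OF sym(2)[OF g] u'(2)]
      B[OF sym(3)[OF g] u'(3)] B[OF sym(2)[OF sym(3)[OF g]] u'(4)] by blast+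
  then show False using two[OF g u] by auto
qed

subsection \<open>Small degrees\<close>

text \<open>No vertex cover of size \<open>m\<close>, phrased through the complementary independent
  set \<open>I\<close> because applications exhibit that set.\<close>

definition no_cover :: "'a \<Rightarrow> nat \<Rightarrow> ('a \<Rightarrow> 'a \<Rightarrow> bool) \<Rightarrow> bool" where
  "no_cover v m J \<longleftrightarrow> (\<forall>I. I \<subseteq> nbrs v \<longrightarrow> card (nbrs v) \<le> card I + m \<longrightarrow> (\<exists>x\<in>I. \<exists>y\<in>I. J x y))"

lemma no_coverD:
  "no_cover v m J \<Longrightarrow> I \<subseteq> nbrs v \<Longrightarrow> card (nbrs v) \<le> card I + m \<Longrightarrow> \<exists>x\<in>I. \<exists>y\<in>I. J x y"
  unfolding no_cover_def by blast

definition no_indep_4 :: "'a \<Rightarrow> ('a \<Rightarrow> 'a \<Rightarrow> bool) \<Rightarrow> bool" where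
  "no_indep_4 v J \<longleftrightarrow> (\<forall>w x y z. distinct [w, x, y, z] \<longrightarrow> {w, x, y, z} \<subseteq> nbrs v \<longrightarrow>
    J w x \<or> J w y \<or> J w z \<or> J x y \<or> J x z \<or> J y z)"

lemma link_matching_2:
  assumes "distinct [a, b, c, d]" "{a, b, c, d} \<subseteq> nbrs v" "adj a b" "adj c d"
  obtains J where "link_graph v J" "\<not> J a b" "\<not> J c d"
    "no_cover v 2 J"
proof -
  have "\<exists>J. link_graph v J \<and> (\<forall>(x, y)\<in>set [(a, b), (c, d)]. \<not> J x y) \<and>
    (\<forall>I. I \<subseteq> nbrs v \<longrightarrow> card (nbrs v) \<le> card I + length [(a, b), (c, d)] \<longrightarrow> (\<exists>x\<in>I. \<exists>y\<in>I. J x y))"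
    using assms by (intro link_matching) auto
  then show thesis using that unfolding no_cover_def by (auto simp: numeral_2_eq_2)
qed

lemma link_matching_3:
  assumes "distinct [a, b, c, d, e, f]" "{a, b, c, d, e, f} \<subseteq> nbrs v" "adj a b" "adj c d" "adj e f"
  obtains J where "link_graph v J" "\<not> J a b" "\<not> J c d" "\<not> J e f"
    "no_cover v 3 J"
proof -
  have "\<exists>J. link_graph v J \<and> (\<forall>(x, y)\<in>set [(a, b), (c, d), (e, f)]. \<not> J x y) \<and>
    (\<forall>I. I \<subseteq> nbrs v \<longrightarrow> card (nbrs v) \<le> card I + length [(a, b), (c, d), (e, f)] \<longrightarrow> (\<exists>x\<in>I. \<exists>y\<in>I. J x y))"
    using assms by (intro link_matching) auto
  then show thesis using that unfolding no_cover_def by (auto simp: numeral_3_eq_3)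
qed

text \<open>Removing a cover of size three from seven neighbours leaves four vertices, so
  \<open>no_cover v 3 J\<close> forbids four independent ones.\<close>

lemma link_7:
  assumes "card (nbrs v) = 7"
    and "distinct [a, b, c, d, e, f]" "{a, b, c, d, e, f} \<subseteq> nbrs v" "adj a b" "adj c d" "adj e f"
  obtains J where "link_graph v J" "\<not> J a b" "\<not> J c d" "\<not> J e f"
"no_indep_4 v J"
proof (rule link_matching_3[OF assms(2-6)])
  fix J assume J: "link_graph v J" "\<not> J a b" "\<not> J c d" "\<not> J e f"
    "no_cover v 3 J"
  show thesis
  proof (rule that[OF J(1-4)], unfold no_indep_4_def, intro allI impI)
    fix w x y z assume "distinct [w, x, y, z]" "{w, x, y, z} \<subseteq> nbrs v"
    moreover from this have "\<exists>p\<in>{w, x, y, z}. \<exists>q\<in>{w, x, y, z}. J p q"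
      using assms(1) by (intro no_coverD[OF J(5)]) auto
    ultimately show "J w x \<or> J w y \<or> J w z \<or> J x y \<or> J x z \<or> J y z"
      using link_graphD(2,3)[OF J(1)] by blast
  qed
qed

text \<open>The Ramsey bound R(3,3) = 6, decided propositionally over the twenty triples of six
  points.\<close>

lemma triangle_free_6:
  assumes "link_graph v J" "distinct [a, b, c, d, e, f]"
    and nJ: "\<not> J a b"
    and ind: "\<And>x y z. distinct [x, y, z] \<Longrightarrow> {x, y, z} \<subseteq> {a, b, c, d, e, f} \<Longrightarrow> J x y \<or> J y z \<or> J x z"
  shows False
proof -
  have sym: "J x y \<longleftrightarrow> J y x" for x y using link_graphD(2)[OF assms(1)] by blast
  have tri: "\<not> (J x y \<and> J y z \<and> J x z)" for x y z using link_graphD(4)[OF assms(1)] by blast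
  have ind': "J x y \<or> J y z \<or> J x z" if "x \<noteq> y" "x \<noteq> z" "y \<noteq> z" "{x, y, z} \<subseteq> {a, b, c, d, e, f}" for x y z
    using ind[of x y z] that by simp
  have ne: "a \<noteq> b" "a \<noteq> c" "a \<noteq> d" "a \<noteq> e" "a \<noteq> f" "b \<noteq> c" "b \<noteq> d" "b \<noteq> e" "b \<noteq> f" "c \<noteq> d" "c \<noteq> e" "c \<noteq> f" "d \<noteq> e" "d \<noteq> f" "e \<noteq> f"
    using assms(2) by auto
  show False
    using nJ
      ind'[of a b c] tri[of a b c]
      ind'[of a b d] tri[of a b d]
      ind'[of a b e] tri[of a b e]
      ind'[of a b f] tri[of a b f]
      ind'[of a c d] tri[of a c d]
      ind'[of a c e] tri[of a c e]
      ind'[of a c f] tri[of a c f]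
      ind'[of a d e] tri[of a d e]
      ind'[of a d f] tri[of a d f]
      ind'[of a e f] tri[of a e f]
      ind'[of b c d] tri[of b c d]
      ind'[of b c e] tri[of b c e]
      ind'[of b c f] tri[of b c f]
      ind'[of b d e] tri[of b d e]
      ind'[of b d f] tri[of b d f]
      ind'[of b e f] tri[of b e f]
      ind'[of c d e] tri[of c d e]
      ind'[of c d f] tri[of c d f]
      ind'[of c e f] tri[of c e f]
      ind'[of d e f] tri[of d e f]
    by (simp only: ne insert_subset insert_iff simp_thms empty_subsetI) argo
qed

lemma degree_ne_6: "card (nbrs v) \<noteq> 6"
proof
  assume card: "card (nbrs v) = 6"
  obtain a b c d e f where m: "distinct [a, b, c, d, e, f]" "{a, b, c, d, e, f} \<subseteq> nbrs v"
    "adj a b" "adj c d" "adj e f"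
    by (rule link_3_matching[of v]) (simp add: card)
  have N: "nbrs v = {a, b, c, d, e, f}"
    using m(1,2) card by (intro card_subset_eq[symmetric]) auto
  obtain J where J: "link_graph v J" "\<not> J a b" "\<not> J c d" "\<not> J e f"
    "no_cover v 3 J"
    using link_matching_3[OF m] by blast
  have "J x y \<or> J y z \<or> J x z" if "distinct [x, y, z]" "{x, y, z} \<subseteq> {a, b, c, d, e, f}" for x y z
  proof -
    have "\<exists>p\<in>{x, y, z}. \<exists>q\<in>{x, y, z}. J p q"
      using that N card by (intro no_coverD[OF J(5)]) auto
    then show ?thesis using link_graphD[OF J(1)] by blast
  qed
  then show False by (rule triangle_free_6[OF J(1) m(1) J(2)])
qed

text \<open>A matching edge itself supplies the forbidden independent set: its two ends are not
  joined in \<open>J\<close>, and two vertices are enough for degree 3 with one matching edge and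
  for degree 4 with two.\<close>

lemma degree_ge_5:
  assumes "adj v x"
  shows "5 \<le> card (nbrs v)"
proof (rule ccontr)
  assume "\<not> ?thesis"
  then have le: "card (nbrs v) \<le> 4" by simp
  obtain y z where yz: "y \<noteq> z" "adj v y" "adj v z" "adj x y" "adj x z"
    using two_common_nbrs[OF assms] by metis
  have d: "distinct [x, y, z]" "{x, y, z} \<subseteq> nbrs v" using yz assms adj_neq by auto
  have "card {x, y, z} = 3" using d(1) by simp
  then have ge: "3 \<le> card (nbrs v)" using d(2) by (metis card_mono finite_nbrs)
  show False
  proof (cases "card (nbrs v) = 3")
    case True
    obtain J where J: "link_graph v J" "\<not> J x y"
      "\<forall>I. I \<subseteq> nbrs v \<longrightarrow> card (nbrs v) \<le> card I + 1 \<longrightarrow> (\<exists>x\<in>I. \<exists>y\<in>I. J x y)"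
      using link_matching[of "[(x, y)]" v] d yz by auto
    have "\<exists>p\<in>{x, y}. \<exists>q\<in>{x, y}. J p q" using d True by (intro J(3)[rule_format]) auto
    then show False using link_graphD[OF J(1)] J(2) by blast
  next
    case False
    then have 4: "card (nbrs v) = 4" using ge le by simp
    then obtain a b c d where m: "distinct [a, b, c, d]" "{a, b, c, d} \<subseteq> nbrs v" "adj a b" "adj c d"
      by (metis le_refl link_2_matching)
    obtain J where J: "link_graph v J" "\<not> J a b" "\<not> J c d"
      "no_cover v 2 J"
      using link_matching_2[OF m] by blast
    have "\<exists>p\<in>{a, b}. \<exists>q\<in>{a, b}. J p q" using m 4 by (intro no_coverD[OF J(4)]) auto
    then show False using link_graphD[OF J(1)] J(2) by blast
  qed
qed

section \<open>Vertices of degree five\<close>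

lemma local_reduction_list:
  assumes "ts \<noteq> []" "distinct (concat (map tri_edges ts))" "card S \<le> 2 * length ts" "finite S"
    and "\<forall>(x, y, z)\<in>set ts. adj x y \<and> adj y z \<and> adj x z"
    and "\<forall>(x, y, z)\<in>set ts. covered S x y \<and> covered S y z \<and> covered S x z"
  shows False
proof (rule local_reduction[OF assms(1,2) _ assms(3,4)])
  show "adj x y \<and> adj y z \<and> adj x z" if "(x, y, z) \<in> set ts" for x y z
    using assms(5) that by fast
  show "covered S x y \<and> covered S y z \<and> covered S x z" if "(x, y, z) \<in> set ts" for x y z
    using assms(6) that by fast
qed

text \<open>Hence the link is K5 minus a matching. If \<open>h\<close> missed \<open>p\<close> and
  \<open>q\<close>, matching \<open>h\<close> to \<open>r\<close> would separate it in
  \<open>J\<close> from \<open>p\<close>, \<open>q\<close> and \<open>r\<close>; as no three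
  vertices are independent in \<open>J\<close>, these three would form a triangle of
  \<open>J\<close>.\<close>

lemma degree_5_link:
  assumes card: "card (nbrs v) = 5" and hpq: "distinct [h, p, q]" "{h, p, q} \<subseteq> nbrs v"
  shows "adj h p \<or> adj h q"
proof (rule ccontr)
  assume "\<not> ?thesis"
  then have n: "\<not> adj h p" "\<not> adj h q" by auto
  have "card (nbrs v - {h, p, q}) = 2" using card hpq by (simp add: card_Diff_subset)
  then obtain r s where rs: "nbrs v - {h, p, q} = {r, s}" "r \<noteq> s" by (auto simp: card_2_iff)
  have N: "nbrs v = {h, p, q, r, s}" using rs hpq by blast
  have "r \<notin> {h, p, q}" "s \<notin> {h, p, q}" using rs by blast+
  then have dist: "distinct [h, p, q, r, s]" using hpq(1) rs(2) by auto
  have in_N: "adj v h" "adj v p" "adj v q" "adj v r" "adj v s"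
    unfolding in_nbrs[symmetric] N by simp_all
  obtain y z where yz: "y \<noteq> z" "adj v y" "adj v z" "adj h y" "adj h z"
    using two_common_nbrs[OF in_N(1)] by metis
  have vN: "z \<in> {h, p, q, r, s}" if "adj v z" for z
    using that unfolding in_nbrs[symmetric] N .
  have "y \<in> {r, s}" "z \<in> {r, s}"
    using vN[OF yz(2)] vN[OF yz(3)] yz(4,5) n adj_irrefl by blast+
  then have hr: "adj h r" using yz by auto
  obtain y z where yz: "y \<noteq> z" "adj v y" "adj v z" "adj p y" "adj p z"
    using two_common_nbrs[OF in_N(2)] by metis
  have "\<not> adj p h" using n adj_sym by blast
  then have "y \<in> {q, r, s}" "z \<in> {q, r, s}"
    using vN[OF yz(2)] vN[OF yz(3)] yz(4,5) adj_irrefl by blast+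
  then obtain t where t: "t \<in> {q, s}" "adj p t" using yz by auto
  have m: "distinct [h, r, p, t]" "{h, r, p, t} \<subseteq> nbrs v" using dist t N by auto
  obtain J where J: "link_graph v J" "\<not> J h r" "\<not> J p t" "no_cover v 2 J"
    using link_matching_2[OF m hr t(2)] by blast
  have nJ: "\<not> J h p" "\<not> J h q" using n link_graphD(1)[OF J(1)] by blast+
  have tri: "J x y" if "distinct [h, x, y]" "{x, y} \<subseteq> nbrs v" "\<not> J h x" "\<not> J h y" for x y
  proof -
    have "\<exists>i\<in>{h, x, y}. \<exists>j\<in>{h, x, y}. J i j"
      using that card hpq by (intro no_coverD[OF J(4)]) auto
    then show ?thesis using that link_graphD(2,3)[OF J(1)] by blast
  qed
  have "J p q" "J q r" "J p r"
    using tri[of p q] tri[of q r] tri[of p r] dist N nJ J(2) by auto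
  then show False using link_graphD(4)[OF J(1)] by blast
qed

text \<open>The non-adjacent pairs form a matching, which leaves at least one of five vertices,
  \<open>h\<close>, joined to all others; only \<open>ab\<close> and \<open>cd\<close> may be
  missing.\<close>

lemma degree_5_labels:
  assumes card: "card (nbrs v) = 5"
  obtains a b c d h where "distinct [a, b, c, d, h]" "nbrs v = {a, b, c, d, h}"
    "adj h a" "adj h b" "adj h c" "adj h d" "adj a c" "adj a d" "adj b c" "adj b d"
proof -
  \<comment> \<open>A non-adjacent pair if there is one; otherwise the link is complete and any pair
    serves.\<close>
  obtain a b where ab: "a \<in> nbrs v" "b \<in> nbrs v" "a \<noteq> b" "adj a b \<Longrightarrow> \<forall>x\<in>nbrs v. \<forall>y\<in>nbrs v. x \<noteq> y \<longrightarrow> adj x y"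
  proof (cases "\<forall>x\<in>nbrs v. \<forall>y\<in>nbrs v. x \<noteq> y \<longrightarrow> adj x y")
    case True
    have "2 \<le> card (nbrs v)" using card by simp
    then obtain a b where "a \<in> nbrs v" "b \<in> nbrs v" "a \<noteq> b" by (rule two_elements)
    then show thesis using that True by blast
  next
    case False
    then show thesis using that by blast
  qed
  have c3: "card (nbrs v - {a, b}) = 3" using ab card by (simp add: card_Diff_subset)
  then obtain p q r where pqr: "nbrs v - {a, b} = {p, q, r}" "p \<noteq> q" "p \<noteq> r" "q \<noteq> r"
    by (auto simp: card_3_iff)
  have N: "nbrs v = {a, b, p, q, r}" using pqr(1) ab by blast
  have "p \<notin> {a, b}" "q \<notin> {a, b}" "r \<notin> {a, b}" using pqr(1) by blast+
  then have dist: "distinct [a, b, p, q, r]" using pqr ab by auto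
  have full: "adj a x \<and> adj b x" if "x \<in> {p, q, r}" for x
  proof -
    have x: "x \<noteq> a" "x \<noteq> b" "x \<in> nbrs v" using that dist N by auto
    have d: "distinct [a, b, x]" "distinct [b, a, x]" "{a, b, x} \<subseteq> nbrs v" "{b, a, x} \<subseteq> nbrs v"
      using ab x by auto
    show ?thesis
    proof (cases "adj a b")
      case True
      have "adj a x" using ab(4)[OF True, THEN bspec, OF ab(1), THEN bspec, OF x(3)] x(1) by simp
      moreover have "adj b x" using ab(4)[OF True, THEN bspec, OF ab(2), THEN bspec, OF x(3)] x(2) by simp
      ultimately show ?thesis ..
    next
      case False
      then have "\<not> adj b a" using adj_sym by blast
      then show ?thesis
        using False degree_5_link[OF card d(1,3)] degree_5_link[OF card d(2,4)] by blast
    qed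
  qed
  have two: "adj x y \<or> adj x z" if "distinct [x, y, z]" "{x, y, z} \<subseteq> {p, q, r}" for x y z
    using degree_5_link[OF card that(1)] that(2) N by blast
  have pq: "(adj p q \<or> adj p r) \<and> (adj q p \<or> adj q r) \<and> (adj r p \<or> adj r q)"
    using two[of p q r] two[of q p r] two[of r p q] pqr(2-4) by (simp add: insert_commute)
  have sym: "adj q p = adj p q" "adj r p = adj p r" "adj r q = adj q r"
    using adj_sym by blast+
  have fl: "adj p a" "adj p b" "adj q a" "adj q b" "adj r a" "adj r b"
    using full adj_sym by blast+
  consider "adj r p" "adj r q" | "adj q p" "adj q r" | "adj p q" "adj p r"
    using pq sym by blast
  then show thesis
  proof cases
    case 1
    then show thesis using that[of a b p q r] dist N full fl by (auto simp: insert_commute)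
  next
    case 2
    then show thesis using that[of a b p r q] dist N full fl by (auto simp: insert_commute)
  next
    case 3
    then show thesis using that[of a b q r p] dist N full fl by (auto simp: insert_commute)
  qed
qed

text \<open>Otherwise four triangles are reducible. \<open>S\<close> leaves only edges between
  \<open>{v, h}\<close> and \<open>{a, b, c, d}\<close> among these six vertices and cuts
  \<open>h\<close> off from its other neighbours \<open>W\<close>. Five of its edges are always
  present; \<open>ab\<close>, \<open>cd\<close> and \<open>W\<close> contribute at most three, since
  \<open>card W\<close> is at most 2, and at most 1 when both \<open>ab\<close> and
  \<open>cd\<close> are edges and the claim fails.\<close>

lemma degree_5_labelled:
  assumes dist: "distinct [a, b, c, d, h]" and N: "nbrs v = {a, b, c, d, h}"
    and adj: "adj h a" "adj h b" "adj h c" "adj h d" "adj a c" "adj a d" "adj b c" "adj b d"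
  shows "adj a b \<and> adj c d \<and> card (nbrs h) = 7"
proof (rule ccontr)
  assume contr: "\<not> ?thesis"
  define W where "W = nbrs h - {v, a, b, c, d}"
  define S where "S = {{a, c}, {b, d}, {a, d}, {b, c}, {v, h}} \<union> ({{a, b}, {c, d}} \<inter> E) \<union> (\<lambda>w. {h, w}) ` W"
  let ?ts = "[(v, a, c), (v, b, d), (h, a, d), (h, b, c)]"
  have v: "adj v a" "adj v b" "adj v c" "adj v d" "adj v h"
    unfolding in_nbrs[symmetric] N by simp_all
  have vne: "v \<noteq> a" "v \<noteq> b" "v \<noteq> c" "v \<noteq> d" "v \<noteq> h" using v adj_neq by blast+
  have vN: "z = a \<or> z = b \<or> z = c \<or> z = d \<or> z = h" if "adj v z" for z
    using that unfolding in_nbrs[symmetric] N by simp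
  have hN: "z = a \<or> z = b \<or> z = c \<or> z = d \<or> z = v \<or> z \<in> W" if "adj h z" for z
    using that by (auto simp: W_def)
  have S: "{a, c} \<in> S" "{b, d} \<in> S" "{a, d} \<in> S" "{b, c} \<in> S" "{v, h} \<in> S" "{h, v} \<in> S"
    "{c, a} \<in> S" "{d, b} \<in> S" "{d, a} \<in> S" "{c, b} \<in> S"
    "adj a b \<Longrightarrow> {a, b} \<in> S" "adj b a \<Longrightarrow> {b, a} \<in> S" "adj c d \<Longrightarrow> {c, d} \<in> S" "adj d c \<Longrightarrow> {d, c} \<in> S"
    "w \<in> W \<Longrightarrow> {h, w} \<in> S" for w
    by (auto simp: S_def adj_def insert_commute)
  have cov: "covered S v a" "covered S v b" "covered S v c" "covered S v d"
    "covered S h a" "covered S h b" "covered S h c" "covered S h d"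
    "covered S a c" "covered S b d" "covered S a d" "covered S b c"
    unfolding covered_def using vN hN S adj_irrefl by metis+
  have "adj h v" using v(5) adj_sym by blast
  then have sub: "{v, a, b, c, d} \<subseteq> nbrs h" using adj by simp
  have "card {v, a, b, c, d} = 5" using dist vne by auto
  then have W: "card W = card (nbrs h) - 5" "finite W"
    using sub by (simp_all add: W_def card_Diff_subset)
  have "card ({{a, b}, {c, d}} \<inter> E) + card W \<le> 3"
  proof (cases "adj a b \<and> adj c d")
    case True
    then have "card (nbrs h) \<le> 6" using contr card_nbrs_le[of h] by linarith
    moreover have "card ({{a, b}, {c, d}} \<inter> E) \<le> 2"
      by (rule order.trans[OF card_mono[of "{{a, b}, {c, d}}"]]) (auto simp: card_insert_if)
    ultimately show ?thesis using W by linarith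
  next
    case False
    then have sub: "{{a, b}, {c, d}} \<inter> E \<subseteq> {if adj a b then {a, b} else {c, d}}"
      by (auto simp: adj_def)
    have "card ({{a, b}, {c, d}} \<inter> E) \<le> 1"
      using card_mono[OF _ sub] by simp
    then show ?thesis using W card_nbrs_le[of h] by linarith
  qed
  moreover have "card S \<le> card {{a, c}, {b, d}, {a, d}, {b, c}, {v, h}} + card ({{a, b}, {c, d}} \<inter> E) + card ((\<lambda>w. {h, w}) ` W)"
    unfolding S_def by (meson add_le_mono card_Un_le le_refl order.trans)
  moreover have "card {{a, c}, {b, d}, {a, d}, {b, c}, {v, h}} \<le> 5" by (simp add: card_insert_if)
  moreover have "card ((\<lambda>w. {h, w}) ` W) \<le> card W" using W by (intro card_image_le)
  ultimately have "card S \<le> 2 * length ?ts" by simp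
  moreover have "finite S" using W by (simp add: S_def)
  moreover have "distinct (concat (map tri_edges ?ts))"
    using dist vne by (auto simp: tri_edges_def doubleton_eq_iff)
  ultimately show False
    using local_reduction_list[of ?ts S] cov v adj by simp
qed

text \<open>By \<open>degree_5_labelled\<close>, \<open>v\<close> and its neighbours form a K6 and
  each neighbour \<open>x\<close> has exactly two further neighbours, the set \<open>W x\<close>.
  The set \<open>S\<close> used there now exceeds the budget by one edge. A fifth triangle repairs
  this if some \<open>W h\<close> spans an edge or two of these sets meet; otherwise no triangle on
  an edge of the K6 leaves it.\<close>

lemma degree_ne_5: "card (nbrs v) \<noteq> 5"
proof
  assume card: "card (nbrs v) = 5"
  obtain a b c d h where lab: "distinct [a, b, c, d, h]" "nbrs v = {a, b, c, d, h}"
    "adj h a" "adj h b" "adj h c" "adj h d" "adj a c" "adj a d" "adj b c" "adj b d"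
    by (rule degree_5_labels[OF card])
  have "adj a b" "adj c d" using degree_5_labelled[OF lab] by auto
  then have clique: "adj x y" if "x \<in> nbrs v" "y \<in> nbrs v" "x \<noteq> y" for x y
    using that lab(3-10) adj_sym unfolding lab(2) insert_iff empty_iff by metis
  define W where "W x = nbrs x - insert v (nbrs v)" for x
  have fin_W: "finite (W x)" for x by (simp add: W_def)
  have v_notin: "v \<notin> nbrs v" by simp
  have deg: "card (nbrs x) = 7" if x: "x \<in> nbrs v" for x
  proof -
    have "card (nbrs v - {x}) = 4" using card x by simp
    then obtain p q r s where pqrs: "nbrs v - {x} = {p, q, r, s}" "distinct [p, q, r, s]"
      by (auto simp: card_Suc_eq numeral_eq_Suc)
    then have N: "nbrs v = {p, q, r, s, x}" using x by blast
    have "x \<notin> {p, q, r, s}" using pqrs(1) by blast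
    then have dist: "distinct [p, q, r, s, x]" using pqrs(2) by auto
    have "card (nbrs x) = 7"
      using degree_5_labelled[OF dist N] clique dist unfolding N by auto
    then show ?thesis .
  qed
  have card_W: "card (W x) = 2" if x: "x \<in> nbrs v" for x
  proof -
    have "v \<in> nbrs x" using x adj_sym by auto
    moreover have "y \<in> nbrs x" if "y \<in> nbrs v - {x}" for y
      using clique[OF x, of y] that by auto
    ultimately have sub: "insert v (nbrs v - {x}) \<subseteq> nbrs x" by blast
    have "W x = nbrs x - insert v (nbrs v - {x})" by (auto simp: W_def)
    moreover have "card (insert v (nbrs v - {x})) = 5" using x card v_notin by simp
    ultimately show ?thesis using sub deg[OF x] by (simp add: card_Diff_subset)
  qed
  have vadj: "adj x v" if "x \<in> nbrs v" for x using that adj_sym by auto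
  have nb: "z = v \<or> z \<in> nbrs v \<or> z \<in> W x" if "adj x z" for x z
    using that by (auto simp: W_def)
  show False
  proof (cases "\<exists>h\<in>nbrs v. \<exists>w\<in>W h. \<exists>w'\<in>W h. adj w w'")
    case True
    then obtain h w w' where h: "h \<in> nbrs v" "w \<in> W h" "w' \<in> W h" "adj w w'" by blast
    have "w \<noteq> w'" using h(4) adj_neq by blast
    then have Wh: "W h = {w, w'}"
      using h(2,3) card_W[OF h(1)] fin_W by (metis card_2_iff insert_iff singletonD doubleton_eq_iff)
    have "card (nbrs v - {h}) = 4" using card h(1) by simp
    then obtain a b c d where abcd: "nbrs v - {h} = {a, b, c, d}" "distinct [a, b, c, d]"
      by (auto simp: card_Suc_eq numeral_eq_Suc)
    then have N: "nbrs v = {a, b, c, d, h}" using h(1) by blast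
    have "h \<notin> {a, b, c, d}" using abcd(1) by blast
    then have dist: "distinct [a, b, c, d, h]" using abcd(2) by auto
    have "w \<notin> insert v (nbrs v)" "w' \<notin> insert v (nbrs v)" using h by (auto simp: W_def)
    then have dist': "distinct [a, b, c, d, h, v, w, w']"
      using dist v_notin \<open>w \<noteq> w'\<close> unfolding N by auto
    have rdist: "distinct [h, d, c, b, a]" using dist by auto
    have A: "adj v a" "adj v b" "adj v c" "adj v d" "adj h a" "adj h b" "adj h c" "adj h d"
      "adj a c" "adj a d" "adj b c" "adj b d" "adj v h"
      unfolding in_nbrs[symmetric] using clique dist rdist unfolding N by simp_all
    have hw: "adj h w" "adj h w'" using h by (auto simp: W_def)
    have vN: "z = a \<or> z = b \<or> z = c \<or> z = d \<or> z = h" if "adj v z" for z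
      using that unfolding in_nbrs[symmetric] N by simp
    have hN: "z = a \<or> z = b \<or> z = c \<or> z = d \<or> z = v \<or> z = w \<or> z = w'" if "adj h z" for z
      using nb[OF that] that unfolding N Wh by auto
    \<comment> \<open>The fifth triangle raises the budget to ten: nine edges as in
      \<open>degree_5_labelled\<close>, and \<open>w w'\<close>.\<close>
    let ?ts = "[(v, a, c), (v, b, d), (h, a, d), (h, b, c), (h, w, w')]"
    define S where "S = set [{a, c}, {b, d}, {a, d}, {b, c}, {v, h}, {a, b}, {c, d}, {h, w}, {h, w'}, {w, w'}]"
    have S: "{a, c} \<in> S" "{b, d} \<in> S" "{a, d} \<in> S" "{b, c} \<in> S" "{v, h} \<in> S" "{h, v} \<in> S"
      "{c, a} \<in> S" "{d, b} \<in> S" "{d, a} \<in> S" "{c, b} \<in> S" "{a, b} \<in> S" "{b, a} \<in> S"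
      "{c, d} \<in> S" "{d, c} \<in> S" "{h, w} \<in> S" "{h, w'} \<in> S" "{w, w'} \<in> S"
      by (simp_all add: S_def doubleton_eq_iff)
    have cov: "covered S v a" "covered S v b" "covered S v c" "covered S v d"
      "covered S h a" "covered S h b" "covered S h c" "covered S h d"
      "covered S a c" "covered S b d" "covered S a d" "covered S b c"
      "covered S h w" "covered S h w'" "covered S w w'"
      unfolding covered_def using vN hN S adj_irrefl by metis+
    have "card S \<le> 2 * length ?ts" unfolding S_def by (rule order.trans[OF card_length]) simp
    moreover have "finite S" by (simp add: S_def)
    moreover have "distinct (concat (map tri_edges ?ts))"
      using dist' by (auto simp: tri_edges_def doubleton_eq_iff)
    ultimately show False
      using local_reduction_list[of ?ts S] cov A hw h(4) by simp
  next
    case F1: False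
    show False
    proof (cases "\<exists>a\<in>nbrs v. \<exists>b\<in>nbrs v. a \<noteq> b \<and> W a \<inter> W b \<noteq> {}")
      case True
      then obtain a b w where ab: "a \<in> nbrs v" "b \<in> nbrs v" "a \<noteq> b" "w \<in> W a" "w \<in> W b" by blast
      have "card (nbrs v - {a, b}) = 3" using card ab by (simp add: card_Diff_subset)
      then obtain c d e where cde: "nbrs v - {a, b} = {c, d, e}" "distinct [c, d, e]"
        by (auto simp: card_Suc_eq numeral_eq_Suc)
      then have N: "nbrs v = {a, b, c, d, e}" using ab by blast
      have "a \<notin> {c, d, e}" "b \<notin> {c, d, e}" using cde(1) by blast+
      then have "distinct [a, b, c, d, e]" using cde(2) ab(3) by auto
      moreover have "w \<notin> insert v (nbrs v)" using ab by (auto simp: W_def)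
      ultimately have dist: "distinct [a, b, c, d, e, v, w]" using v_notin unfolding N by auto
      \<comment> \<open>All ten edges among the neighbours of \<open>v\<close>, exactly the budget
        of five triangles. By \<open>F1\<close> a triangle on an edge \<open>xw\<close> has its
        third vertex among these neighbours too, so it is hit.\<close>
      define S where "S = set [{a, b}, {a, c}, {a, d}, {a, e}, {b, c}, {b, d}, {b, e}, {c, d}, {c, e}, {d, e}]"
      have S: "{x, y} \<in> S" if "x \<in> nbrs v" "y \<in> nbrs v" "x \<noteq> y" for x y
        using that unfolding N insert_iff empty_iff by (elim disjE) (simp_all add: S_def doubleton_eq_iff)
      have cov_v: "covered S v x" "covered S x v" if "x \<in> nbrs v" for x
        unfolding covered_def using S that adj_neq by auto
      have cov_N: "covered S x y" if "x \<in> nbrs v" "y \<in> nbrs v" "x \<noteq> y" for x y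
        unfolding covered_def using S that by auto
      have cov_w: "covered S x w" if "x \<in> nbrs v" "w \<in> W x" for x
        unfolding covered_def
      proof (intro allI impI)
        fix z assume z: "adj x z" "adj w z"
        have "\<not> adj w v" using that(2) adj_sym by (auto simp: W_def)
        then have "z \<noteq> v" using z by blast
        moreover have "z \<notin> W x" using F1 that z(2) by blast
        ultimately have "z \<in> nbrs v" using nb[OF z(1)] by blast
        then show "{x, w} \<in> S \<or> {x, z} \<in> S \<or> {w, z} \<in> S"
          using S[OF that(1), of z] z(1) adj_neq by blast
      qed
      let ?ts = "[(a, c, v), (a, d, e), (b, c, e), (b, d, v), (a, b, w)]"
      have in_N: "a \<in> nbrs v" "b \<in> nbrs v" "c \<in> nbrs v" "d \<in> nbrs v" "e \<in> nbrs v"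
        unfolding N by simp_all
      have cl: "adj a b" "adj a c" "adj a d" "adj a e" "adj b c" "adj b d" "adj b e" "adj c e" "adj d e"
        "adj a v" "adj b v" "adj c v" "adj d v" "adj a w" "adj b w"
        using clique in_N dist vadj ab(4,5) by (simp_all add: W_def)
      have "card S \<le> 2 * length ?ts" unfolding S_def by (rule order.trans[OF card_length]) simp
      moreover have "finite S" by (simp add: S_def)
      moreover have "distinct (concat (map tri_edges ?ts))"
        using dist by (auto simp: tri_edges_def doubleton_eq_iff)
      moreover have "\<forall>(x, y, z)\<in>set ?ts. covered S x y \<and> covered S y z \<and> covered S x z"
        using cov_v cov_N cov_w in_N ab dist by simp
      ultimately show False
        using local_reduction_list[of ?ts S] cl by simp
    next
      case False
      then have F2: "W x \<inter> W y = {}" if "x \<in> nbrs v" "y \<in> nbrs v" "x \<noteq> y" for x y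
        using that by blast
      have N: "nbrs v = {a, b, c, d, h}" and dist: "distinct [a, b, c, d, h, v]"
        using lab(1,2) v_notin by auto
      have in_N: "a \<in> nbrs v" "b \<in> nbrs v" "c \<in> nbrs v" "d \<in> nbrs v" "h \<in> nbrs v"
        unfolding N by simp_all
      \<comment> \<open>Two disjoint triangles, whose removal turns the K6 into K(3,3); disjointness
        of the sets \<open>W x\<close> excludes triangles with a vertex outside.\<close>
      define S where "S = set [{v, a}, {v, b}, {a, b}, {c, d}, {c, h}, {d, h}]"
      have S: "{v, a} \<in> S" "{v, b} \<in> S" "{a, b} \<in> S" "{c, d} \<in> S" "{c, h} \<in> S" "{d, h} \<in> S"
        "{a, v} \<in> S" "{b, v} \<in> S" "{b, a} \<in> S" "{d, c} \<in> S" "{h, c} \<in> S" "{h, d} \<in> S"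
        by (simp_all add: S_def doubleton_eq_iff)
      have vN: "z = a \<or> z = b \<or> z = c \<or> z = d \<or> z = h" if "adj v z" for z
        using that unfolding in_nbrs[symmetric] N by simp
      have comm: "z = v \<or> z = a \<or> z = b \<or> z = c \<or> z = d \<or> z = h"
        if "x \<in> nbrs v" "y \<in> nbrs v" "x \<noteq> y" "adj x z" "adj y z" for x y z
        using nb[OF that(4)] nb[OF that(5)] F2[OF that(1-3)] unfolding N by auto
      have cov: "covered S a c" "covered S c v" "covered S a v" "covered S a d" "covered S d h"
        "covered S a h" "covered S b c" "covered S c h" "covered S b h" "covered S b d" "covered S d v" "covered S b v"
        unfolding covered_def
        using comm[OF in_N(1,3)] comm[OF in_N(1,4)] comm[OF in_N(1,5)] comm[OF in_N(2,3)]
          comm[OF in_N(2,4)] comm[OF in_N(2,5)] vN S dist adj_irrefl by (auto; metis)+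
      let ?ts = "[(a, c, v), (a, d, h), (b, c, h), (b, d, v)]"
      have cl: "adj a c" "adj a d" "adj a h" "adj b c" "adj b d" "adj b h" "adj c h" "adj d h"
        "adj a v" "adj b v" "adj c v" "adj d v"
        using clique in_N dist vadj by simp_all
      have "card S \<le> 2 * length ?ts" unfolding S_def by (rule order.trans[OF card_length]) simp
      moreover have "finite S" by (simp add: S_def)
      moreover have "distinct (concat (map tri_edges ?ts))"
        using dist by (auto simp: tri_edges_def doubleton_eq_iff)
      ultimately show False
        using local_reduction_list[of ?ts S] cov cl by simp
    qed
  qed
qed

lemma degree_7:
  assumes "adj v x"
  shows "card (nbrs v) = 7"
  using degree_ge_5[OF assms] degree_ne_5[of v] degree_ne_6[of v] card_nbrs_le[of v] by linarith

subsection \<open>Edges in two triangles\<close>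

text \<open>Non-adjacent vertices stay non-adjacent in \<open>J\<close>, whichever 3-matching is
  chosen.\<close>

lemma link_indep_4:
  assumes "card (nbrs v) = 7" "distinct [w, x, y, z]" "{w, x, y, z} \<subseteq> nbrs v"
  shows "adj w x \<or> adj w y \<or> adj w z \<or> adj x y \<or> adj x z \<or> adj y z"
proof -
  have "6 \<le> card (nbrs v)" using assms(1) by simp
  then obtain a b c d e f where m: "distinct [a, b, c, d, e, f]" "{a, b, c, d, e, f} \<subseteq> nbrs v"
    "adj a b" "adj c d" "adj e f"
    by (rule link_3_matching)
  obtain J where J: "link_graph v J" "no_indep_4 v J"
    using link_7[OF assms(1) m] by blast
  have "J w x \<or> J w y \<or> J w z \<or> J x y \<or> J x z \<or> J y z"
    using J(2) assms(2,3) unfolding no_indep_4_def by blast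
  then show ?thesis using link_graphD(1)[OF J(1)] by blast
qed

lemma no_indep_4D:
  "no_indep_4 v J \<Longrightarrow> distinct [w, x, y, z] \<Longrightarrow> {w, x, y, z} \<subseteq> nbrs v \<Longrightarrow>
    J w x \<or> J w y \<or> J w z \<or> J x y \<or> J x z \<or> J y z"
  unfolding no_indep_4_def by blast

text \<open>With \<open>wc\<close> in the matching, \<open>pq\<close> is the only pair inside
  \<open>{w, c, p, q}\<close> that \<open>J\<close> can join. So \<open>pq\<close> is an edge and no
  such 3-matching uses it.\<close>

lemma codegree_2_matching:
  assumes card: "card (nbrs v) = 7" and dist: "distinct [w, c, c', a, a', p, q]"
    and N: "nbrs v = {w, c, c', a, a', p, q}"
    and wc: "adj w c" and w: "\<not> adj w a" "\<not> adj w a'" "\<not> adj w p" "\<not> adj w q"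
    and cpq: "\<not> adj c p" "\<not> adj c q"
    and m: "distinct [e, e', f, f']" "{e, e', f, f'} \<subseteq> {a, a', p, q, c'}" "adj e e'" "adj f f'"
  shows "adj p q \<and> {e, e'} \<noteq> {p, q} \<and> {f, f'} \<noteq> {p, q}"
proof -
  have "w \<notin> {a, a', p, q, c'}" "c \<notin> {a, a', p, q, c'}" using dist by auto
  then have "w \<notin> {e, e', f, f'}" "c \<notin> {e, e', f, f'}" using m(2) by blast+
  then have md: "distinct [w, c, e, e', f, f']" using m(1) dist by auto
  have mN: "{w, c, e, e', f, f'} \<subseteq> nbrs v" using m(2) unfolding N by auto
  obtain J where J: "link_graph v J" "\<not> J w c" "\<not> J e e'" "\<not> J f f'" "no_indep_4 v J"
    using link_7[OF card md mN wc m(3,4)] by blast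
  note JD = link_graphD[OF J(1)]
  have nJ: "\<not> J w a" "\<not> J w a'" "\<not> J w p" "\<not> J w q" "\<not> J c p" "\<not> J c q"
    using w cpq JD(1) by blast+
  have "J p q"
    using no_indep_4D[OF J(5), of w c p q] nJ J(2) dist unfolding N by auto
  moreover from this have "J q p" "adj p q" using JD(1,2) by blast+
  ultimately show ?thesis using J(3,4) by (auto simp: doubleton_eq_iff)
qed

text \<open>The common neighbours exchange roles. If \<open>c\<close> misses \<open>p\<close> and
  \<open>q\<close>, then \<open>key\<close> shows that \<open>c'\<close> misses \<open>a\<close> and
  \<open>a'\<close>, which are not adjacent; applied to \<open>c'\<close> in turn, it makes
  \<open>a\<close> and \<open>a'\<close> adjacent.\<close>

lemma codegree_2_side:
  assumes card: "card (nbrs v) = 7" and dist: "distinct [w, c, c', a, a', p, q]"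
    and N: "nbrs v = {w, c, c', a, a', p, q}"
    and wc: "adj w c" "adj w c'" and w: "\<not> adj w a" "\<not> adj w a'" "\<not> adj w p" "\<not> adj w q"
    and cpq: "\<not> adj c p" "\<not> adj c q"
  shows False
proof -
  have key: "adj p q \<and> \<not> adj a a' \<and> \<not> adj c' a \<and> \<not> adj c' a'"
    if dist: "distinct [w, c, c', a, a', p, q]"
    and N: "nbrs v = {w, c, c', a, a', p, q}"
    and wc: "adj w c" and w: "\<not> adj w a" "\<not> adj w a'" "\<not> adj w p" "\<not> adj w q"
    and cpq: "\<not> adj c p" "\<not> adj c q" for c c' a a' p q
  proof -
    note M = codegree_2_matching[OF card dist N wc w cpq]
    have i: "adj a p \<or> adj a q \<or> adj p q" "adj a' p \<or> adj a' q \<or> adj p q"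
      using link_indep_4[OF card, of w a p q] link_indep_4[OF card, of w a' p q] w dist
      unfolding N by auto
    \<comment> \<open>Without \<open>pq\<close> the five vertices other than \<open>w\<close> and
      \<open>c\<close> cannot contain two disjoint edges, but \<open>p\<close> and \<open>q\<close>
      would each have two neighbours among \<open>c'\<close>, \<open>a\<close>,
      \<open>a'\<close>.\<close>
    have pq: "adj p q"
    proof (rule ccontr)
      assume npq: "\<not> adj p q"
      have no: "\<not> (adj a p \<and> adj a' q)" "\<not> (adj a q \<and> adj a' p)"
        using M[of a p a' q] M[of a q a' p] npq dist by auto
      have two: "\<exists>y z. y \<noteq> z \<and> {y, z} \<subseteq> {c', a, a'} \<and> adj x y \<and> adj x z" if "x \<in> {p, q}" for x
      proof -
        have "adj v x" using that unfolding in_nbrs[symmetric] N by auto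
        then obtain y z where yz: "y \<noteq> z" "adj v y" "adj v z" "adj x y" "adj x z"
          using two_common_nbrs by blast
        have "y \<in> nbrs v" "z \<in> nbrs v" using yz by simp_all
        moreover have "\<not> adj x w" "\<not> adj x c" "\<not> adj x p" "\<not> adj x q"
          using that w cpq npq adj_sym adj_irrefl by blast+
        ultimately have "y \<in> {c', a, a'}" "z \<in> {c', a, a'}"
          using yz(4,5) unfolding N by blast+
        then show ?thesis using yz by blast
      qed
      have flip: "adj a p = adj p a" "adj a q = adj q a" "adj a' p = adj p a'" "adj a' q = adj q a'"
        using adj_sym by blast+
      show False
        using two[of p] two[of q] i no npq unfolding flip by auto
    qed
    moreover have "\<not> adj a a'" "\<not> adj c' a" "\<not> adj c' a'"
      using M[of p q a a'] M[of p q c' a] M[of p q c' a'] pq dist by auto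
    ultimately show ?thesis by blast
  qed
  have *: "adj p q" "\<not> adj a a'" "\<not> adj c' a" "\<not> adj c' a'"
    using key[OF dist N wc(1) w cpq] by auto
  have "distinct [w, c', c, p, q, a, a']" using dist by auto
  moreover have "nbrs v = {w, c', c, p, q, a, a'}" unfolding N by auto
  ultimately have "adj a a'" using key[OF _ _ wc(2) w(3,4,1,2) *(3,4)] by blast
  then show False using *(2) by blast
qed

lemma codegree_2_nbrs:
  assumes vw: "adj v w" and cod: "card (nbrs v \<inter> nbrs w) = 2" and c: "adj v c" "adj w c"
  shows "3 \<le> card (nbrs c \<inter> (nbrs v - nbrs w - {w}))"
proof (rule ccontr)
  let ?A = "nbrs v - nbrs w - {w}"
  assume "\<not> ?thesis"
  then have le: "card (nbrs c \<inter> ?A) \<le> 2" by simp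
  have card: "card (nbrs v) = 7" using degree_7[OF vw] .
  obtain c' where C: "nbrs v \<inter> nbrs w = {c, c'}" "c \<noteq> c'"
    using cod c by (auto simp: card_2_iff doubleton_eq_iff) (metis IntI in_nbrs insert_iff singletonD)
  have "?A = nbrs v - insert w (nbrs v \<inter> nbrs w)" by auto
  moreover have "card (insert w (nbrs v \<inter> nbrs w)) = 3" using cod by simp
  ultimately have A4: "card ?A = 4" using card vw by (subst \<open>?A = _\<close>, subst card_Diff_subset) auto
  have "card ?A = card (nbrs c \<inter> ?A) + card (?A - nbrs c)"
    by (metis Int_Diff_Un Int_commute card_Un_disjoint finite_Diff finite_Int finite_nbrs Int_Diff_disjoint)
  then have "2 \<le> card (?A - nbrs c)" using A4 le by simp
  then obtain p q where pq: "p \<in> ?A - nbrs c" "q \<in> ?A - nbrs c" "p \<noteq> q" by (rule two_elements)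
  have "card (?A - {p, q}) = 2" using A4 pq by (simp add: card_Diff_subset)
  then obtain a a' where aa: "?A - {p, q} = {a, a'}" "a \<noteq> a'" by (auto simp: card_2_iff)
  have Aeq: "?A = {a, a', p, q}" using aa(1) pq by blast
  have N: "nbrs v = {w, c, c', a, a', p, q}"
  proof -
    have "nbrs v = insert w (nbrs v \<inter> nbrs w) \<union> ?A" using vw by auto
    then show ?thesis unfolding Aeq C by auto
  qed
  have "a \<notin> {p, q}" "a' \<notin> {p, q}" using aa(1) by blast+
  moreover have "w \<notin> ?A" "c \<notin> ?A" "c' \<notin> ?A" using C by auto
  moreover have "w \<noteq> c" "w \<noteq> c'" using C adj_irrefl by auto
  ultimately have dist: "distinct [w, c, c', a, a', p, q]"
    unfolding Aeq using aa(2) pq(3) C(2) by auto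
  have "a \<in> ?A" "a' \<in> ?A" "p \<in> ?A" "q \<in> ?A" unfolding Aeq by simp_all
  then have w: "\<not> adj w a" "\<not> adj w a'" "\<not> adj w p" "\<not> adj w q" by simp_all
  have "c' \<in> nbrs v \<inter> nbrs w" using C(1) by simp
  then have "adj w c'" by simp
  then show False using codegree_2_side[OF card dist N c(2) _ w] pq by simp
qed

text \<open>Each end of \<open>vw\<close> has four private neighbours, and a common neighbour
  \<open>c\<close> sees at least three of either four. With \<open>v\<close> and \<open>w\<close>
  this makes eight.\<close>

lemma codegree_ge_3:
  assumes vw: "adj v w"
  shows "3 \<le> card (nbrs v \<inter> nbrs w)"
proof (rule ccontr)
  assume "\<not> ?thesis"
  then have cod: "card (nbrs v \<inter> nbrs w) = 2" using codegree_ge_2[OF vw] by simp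
  then have "nbrs v \<inter> nbrs w \<noteq> {}" by auto
  then obtain c where c: "adj v c" "adj w c" by auto
  let ?A = "nbrs c \<inter> (nbrs v - nbrs w - {w})" and ?B = "nbrs c \<inter> (nbrs w - nbrs v - {v})"
  have wv: "adj w v" using vw adj_sym by blast
  have "card (nbrs w \<inter> nbrs v) = 2" using cod by (simp add: Int_commute)
  then have "3 \<le> card ?A" "3 \<le> card ?B"
    using codegree_2_nbrs[OF vw cod c] codegree_2_nbrs[OF wv _ c(2,1)] by auto
  moreover have "card ({v, w} \<union> (?A \<union> ?B)) = 2 + (card ?A + card ?B)"
  proof -
    have "card (?A \<union> ?B) = card ?A + card ?B" by (intro card_Un_disjoint) auto
    moreover have "v \<noteq> w" using vw adj_neq by blast
    ultimately show ?thesis by (subst card_Un_disjoint) auto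
  qed
  moreover have "{v, w} \<union> (?A \<union> ?B) \<subseteq> nbrs c" using c adj_sym by auto
  then have "card ({v, w} \<union> (?A \<union> ?B)) \<le> 7"
    using card_nbrs_le[of c] by (meson card_mono finite_nbrs order.trans)
  ultimately show False by linarith
qed

subsection \<open>Edges in three triangles\<close>

text \<open>Three candidates for at least three common neighbours must all qualify and differ.
  Calling it with a repeated candidate therefore yields a contradiction.\<close>

lemma three_common_nbrs:
  assumes "adj v u" "{x. adj v x \<and> adj u x} \<subseteq> {p, q, r}"
  shows "adj u p \<and> adj u q \<and> adj u r \<and> p \<noteq> q \<and> p \<noteq> r \<and> q \<noteq> r"
proof -
  have eq: "{x. adj v x \<and> adj u x} = nbrs v \<inter> nbrs u" by auto
  obtain a b c where abc: "a \<in> nbrs v \<inter> nbrs u" "b \<in> nbrs v \<inter> nbrs u" "c \<in> nbrs v \<inter> nbrs u"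
    "a \<noteq> b" "a \<noteq> c" "b \<noteq> c"
    by (rule three_elements[OF codegree_ge_3[OF assms(1)]])
  then have "a \<in> {p, q, r}" "b \<in> {p, q, r}" "c \<in> {p, q, r}" using assms(2) unfolding eq by blast+
  moreover have "adj u a" "adj u b" "adj u c" using abc by simp_all
  ultimately show ?thesis using abc(4-6) by auto
qed

lemma eight_nbrs:
  assumes "distinct [a1, a2, a3, a4, a5, a6, a7, a8]"
    and "adj c a1" "adj c a2" "adj c a3" "adj c a4" "adj c a5" "adj c a6" "adj c a7" "adj c a8"
  shows False
proof -
  have "card (set [a1, a2, a3, a4, a5, a6, a7, a8]) = 8"
    using distinct_card[OF assms(1)] by simp
  moreover have "set [a1, a2, a3, a4, a5, a6, a7, a8] \<subseteq> nbrs c" using assms by simp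
  ultimately have "8 \<le> card (nbrs c)" by (metis card_mono finite_nbrs)
  then show False using card_nbrs_le[of c] by linarith
qed

text \<open>\<open>c1\<close>, \<open>c2\<close>, \<open>c3\<close> are the common neighbours of
  \<open>v\<close> and \<open>w\<close>; \<open>x\<close>, \<open>y\<close>, \<open>z\<close> are
  private to \<open>v\<close>. Naming them all turns symmetry into permutation of arguments.\<close>

definition codegree_3 :: "'a \<Rightarrow> 'a \<Rightarrow> 'a \<Rightarrow> 'a \<Rightarrow> 'a \<Rightarrow> 'a \<Rightarrow> 'a \<Rightarrow> 'a \<Rightarrow> bool" where
  "codegree_3 v w c1 c2 c3 x y z \<longleftrightarrow> distinct [w, c1, c2, c3, x, y, z] \<and>
    nbrs v = {w, c1, c2, c3, x, y, z} \<and> adj w c1 \<and> adj w c2 \<and> adj w c3 \<and>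
    \<not> adj w x \<and> \<not> adj w y \<and> \<not> adj w z"

lemma codegree_3_perm:
  assumes "codegree_3 v w c1 c2 c3 x y z"
  shows "codegree_3 v w c2 c1 c3 x y z" "codegree_3 v w c1 c3 c2 x y z"
    "codegree_3 v w c1 c2 c3 y x z" "codegree_3 v w c1 c2 c3 x z y"
  using assms unfolding codegree_3_def by auto

text \<open>One of the three perfect matchings on the four vertices \<open>c\<close>,
  \<open>x\<close>, \<open>y\<close>, \<open>z\<close>.\<close>

definition pair_ok :: "'a \<Rightarrow> 'a \<Rightarrow> 'a \<Rightarrow> 'a \<Rightarrow> bool" where
  "pair_ok c x y z \<longleftrightarrow> adj c x \<and> adj y z"

text \<open>At least two of these three perfect matchings are present, which together form a
  4-cycle.\<close>

definition two_ok :: "'a \<Rightarrow> 'a \<Rightarrow> 'a \<Rightarrow> 'a \<Rightarrow> bool" where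
  "two_ok c x y z \<longleftrightarrow> (pair_ok c x y z \<and> pair_ok c y x z) \<or>
    (pair_ok c x y z \<and> pair_ok c z x y) \<or> (pair_ok c y x z \<and> pair_ok c z x y)"

text \<open>The obstruction to extending the matching \<open>w c1\<close>, \<open>yz\<close> by a
  third edge inside \<open>{x, c2, c3}\<close>.\<close>

definition exceptional :: "'a \<Rightarrow> 'a \<Rightarrow> 'a \<Rightarrow> 'a \<Rightarrow> 'a \<Rightarrow> bool" where
  "exceptional c2 c3 x y z \<longleftrightarrow> adj y z \<and> \<not> adj x c2 \<and> \<not> adj x c3 \<and> \<not> adj c2 c3"

text \<open>The shape left by \<open>two_ok\<close> when \<open>c\<close> does not see all three
  private neighbours: the 4-cycle \<open>c e d f\<close> without the chord
  \<open>cd\<close>.\<close>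

definition misses :: "'a \<Rightarrow> 'a \<Rightarrow> 'a \<Rightarrow> 'a \<Rightarrow> bool" where
  "misses c d e f \<longleftrightarrow> \<not> adj c d \<and> adj c e \<and> adj c f \<and> adj d e \<and> adj d f"

lemma two_ok_misses:
  assumes "two_ok c x y z" "\<not> (adj c x \<and> adj c y \<and> adj c z)"
  shows "misses c x y z \<or> misses c y x z \<or> misses c z x y"
proof -
  have "adj y x = adj x y" "adj z x = adj x z" "adj z y = adj y z" using adj_sym by blast+
  then show ?thesis using assms unfolding two_ok_def pair_ok_def misses_def by blast
qed

lemma misses_swap: "misses c d e f \<longleftrightarrow> misses c d f e"
  unfolding misses_def by blast

lemma codegree_3_link:
  assumes s: "codegree_3 v w c1 c2 c3 x y z"
    and m: "distinct [a, b, e, e', f, f']" "{a, b, e, e', f, f'} \<subseteq> {w, c1, c2, c3, x, y, z}"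
      "adj a b" "adj e e'" "adj f f'"
  obtains J where "link_graph v J" "\<not> J a b" "\<not> J e e'" "\<not> J f f'"
    "\<And>p q r s. distinct [p, q, r, s] \<Longrightarrow> {p, q, r, s} \<subseteq> {w, c1, c2, c3, x, y, z} \<Longrightarrow>
      J p q \<or> J p r \<or> J p s \<or> J q r \<or> J q s \<or> J r s"
proof -
  have N: "nbrs v = {w, c1, c2, c3, x, y, z}" using s by (simp add: codegree_3_def)
  then have "adj v w" unfolding in_nbrs[symmetric] by simp
  then have card: "card (nbrs v) = 7" by (rule degree_7)
  obtain J where J: "link_graph v J" "\<not> J a b" "\<not> J e e'" "\<not> J f f'" "no_indep_4 v J"
    using link_7[OF card m(1) _ m(3-5)] m(2) unfolding N by blast
  show thesis
    by (rule that[OF J(1-4)]) (use J(5) in \<open>simp only: no_indep_4_def N\<close>)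
qed

text \<open>For a matching containing \<open>{w, c1}\<close> the remainder has no three independent vertices among
  \<open>c1, x, y, z\<close>; being triangle-free, it contains a perfect matching of these four vertices.\<close>

lemma codegree_3_matching:
  assumes s: "codegree_3 v w c1 c2 c3 x y z" and yz: "adj y z"
  shows "exceptional c2 c3 x y z \<or> pair_ok c1 y x z \<or> pair_ok c1 z x y"
proof (rule ccontr)
  assume contr: "\<not> ?thesis"
  then obtain g g' where g: "(g, g') \<in> {(x, c2), (x, c3), (c2, c3)}" "adj g g'"
    using yz unfolding exceptional_def by blast
  have d: "distinct [w, c1, c2, c3, x, y, z]" and wc: "adj w c1"
    and w: "\<not> adj w x" "\<not> adj w y" "\<not> adj w z" using s by (auto simp: codegree_3_def)
  have "distinct [w, c1, y, z, g, g']" "{w, c1, y, z, g, g'} \<subseteq> {w, c1, c2, c3, x, y, z}"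
    using d g by auto
  then obtain J where J: "link_graph v J" "\<not> J w c1" "\<not> J y z" "\<not> J g g'"
    "\<And>p q r s. distinct [p, q, r, s] \<Longrightarrow> {p, q, r, s} \<subseteq> {w, c1, c2, c3, x, y, z} \<Longrightarrow>
      J p q \<or> J p r \<or> J p s \<or> J q r \<or> J q s \<or> J r s"
    using codegree_3_link[OF s _ _ wc yz g(2)] by blast
  have nJ: "\<not> J w x" "\<not> J w y" "\<not> J w z" using w link_graphD(1)[OF J(1)] by blast+
  have "J x y \<or> J x z" using J(5)[of w x y z] nJ J(3) d by auto
  moreover have "J c1 y \<or> J c1 z" using J(5)[of w c1 y z] nJ J(2,3) d by auto
  moreover have "J c1 x \<or> J c1 y \<or> J x y" using J(5)[of w c1 x y] nJ J(2) d by auto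
  moreover have "J c1 x \<or> J c1 z \<or> J x z" using J(5)[of w c1 x z] nJ J(2) d by auto
  moreover have "\<not> (J c1 x \<and> J x y \<and> J c1 y)" "\<not> (J c1 x \<and> J x z \<and> J c1 z)"
    using link_graphD(4)[OF J(1)] by blast+
  ultimately have "(J c1 y \<and> J x z) \<or> (J c1 z \<and> J x y)" by blast
  then show False using contr link_graphD(1)[OF J(1)] unfolding pair_ok_def by blast
qed

lemma exceptional_nbrs:
  assumes s: "codegree_3 v w c1 c2 c3 x y z" and e: "exceptional c2 c3 x y z"
  shows "adj x c1 \<and> adj x y \<and> adj x z"
proof -
  have N: "nbrs v = {w, c1, c2, c3, x, y, z}" and "\<not> adj w x" using s by (auto simp: codegree_3_def)
  then have "adj v x" "\<not> adj x w" unfolding in_nbrs[symmetric] using adj_sym by auto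
  moreover have "{u. adj v u \<and> adj x u} \<subseteq> {c1, y, z}"
    using e \<open>\<not> adj x w\<close> adj_irrefl unfolding in_nbrs[of _ v, symmetric] N exceptional_def by blast
  ultimately show ?thesis using three_common_nbrs by blast
qed

lemma two_ok_swap: "two_ok c x y z \<Longrightarrow> two_ok c y x z" "two_ok c x y z \<Longrightarrow> two_ok c x z y"
  using adj_sym unfolding two_ok_def pair_ok_def by blast+

text \<open>Some edge joins two of \<open>x\<close>, \<open>y\<close>, \<open>z\<close>, since these
  and \<open>w\<close> are not independent. By \<open>codegree_3_matching\<close> an edge among them
  yields a perfect matching containing a different edge among them, and that edge yields a second
  perfect matching.\<close>

lemma nonexceptional:
  assumes s: "codegree_3 v w c1 c2 c3 x y z"
    and ne: "\<not> exceptional c2 c3 x y z" "\<not> exceptional c2 c3 y x z" "\<not> exceptional c2 c3 z x y"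
  shows "two_ok c1 x y z"
proof -
  have N: "nbrs v = {w, c1, c2, c3, x, y, z}" and d: "distinct [w, c1, c2, c3, x, y, z]"
    and w: "\<not> adj w x" "\<not> adj w y" "\<not> adj w z" using s by (auto simp: codegree_3_def)
  then have "adj v w" unfolding in_nbrs[symmetric] by simp
  then have "adj w x \<or> adj w y \<or> adj w z \<or> adj x y \<or> adj x z \<or> adj y z"
    using d N by (intro link_indep_4[OF degree_7]) auto
  then have A: "adj x y \<or> adj x z \<or> adj y z" using w by blast
  have sym: "adj y x = adj x y" "adj z x = adj x z" "adj z y = adj y z" using adj_sym by blast+
  have 1: "adj y z \<Longrightarrow> pair_ok c1 y x z \<or> pair_ok c1 z x y"
    using codegree_3_matching[OF s] ne by blast
  have 2: "adj x z \<Longrightarrow> pair_ok c1 x y z \<or> pair_ok c1 z y x"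
    using codegree_3_matching[OF codegree_3_perm(3)[OF s]] ne by blast
  have 3: "adj x y \<Longrightarrow> pair_ok c1 x z y \<or> pair_ok c1 y z x"
    using codegree_3_matching[OF codegree_3_perm(3)[OF codegree_3_perm(4)[OF s]]] ne by blast
  show ?thesis using A 1 2 3 unfolding two_ok_def pair_ok_def sym by blast
qed

text \<open>The main gain is the last conjunct: \<open>vx\<close> is again an edge in exactly three
  triangles, with common neighbours \<open>c1\<close>, \<open>y\<close>, \<open>z\<close>. This
  allows \<open>not_exceptional\<close> to pass to the end \<open>x\<close> of that edge.\<close>

lemma exceptional_structure:
  assumes s: "codegree_3 v w c1 c2 c3 x y z" and e: "exceptional c2 c3 x y z"
  shows "adj x y \<and> adj x z \<and> adj y z \<and> adj x c1 \<and> adj c1 c2 \<and> adj c1 c3 \<and>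
    adj c2 y \<and> adj c2 z \<and> adj c3 y \<and> adj c3 z \<and> \<not> adj x c2 \<and> \<not> adj x c3 \<and> \<not> adj c2 c3 \<and>
    codegree_3 v x c1 y z w c2 c3"
proof -
  have N: "nbrs v = {w, c1, c2, c3, x, y, z}" and d: "distinct [w, c1, c2, c3, x, y, z]"
    and w: "\<not> adj w x" "\<not> adj w y" "\<not> adj w z" and wc: "adj w c1" "adj w c2" "adj w c3"
    using s by (auto simp: codegree_3_def)
  have x: "adj x c1" "adj x y" "adj x z" using exceptional_nbrs[OF s e] by auto
  have ex: "adj y z" "\<not> adj x c2" "\<not> adj x c3" "\<not> adj c2 c3" using e by (auto simp: exceptional_def)
  have sym: "adj c1 x" "\<not> adj c2 x" "\<not> adj c3 x" "\<not> adj c3 c2" "\<not> adj x w"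
    using x ex w adj_sym by blast+
  have c: "adj c' y \<and> adj c' z"
    if c': "codegree_3 v w c' c1 c'' x y z" "\<not> adj c' x" "\<not> adj c'' x" "\<not> adj c' c''" for c' c''
  proof -
    have N': "nbrs v = {w, c', c1, c'', x, y, z}" using c'(1) by (auto simp: codegree_3_def)
    have vc: "adj v c''" unfolding in_nbrs[symmetric] N' by simp
    \<comment> \<open>If \<open>u\<close> were the exceptional vertex, \<open>w\<close> and
      \<open>t\<close> would be the only neighbours of \<open>c''\<close> in the link.\<close>
    have no: False if u: "\<not> adj c1 c''" "u \<in> {y, z}" "\<not> adj u c''" for u
    proof -
      obtain t where t: "{y, z} = {u, t}" using u(2) by blast
      have "\<not> adj c'' u" "\<not> adj c'' c1" "\<not> adj c'' c'" using u c'(4) adj_sym by blast+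
      moreover have "y \<in> {u, t}" "z \<in> {u, t}" using t by blast+
      moreover have "r \<in> {w, c', c1, c'', x, y, z}" if "adj v r" for r
        using that unfolding in_nbrs[of _ v, symmetric] N' .
      ultimately have "{r. adj v r \<and> adj c'' r} \<subseteq> {w, t, t}"
        using c'(3) adj_irrefl by blast
      then show False using three_common_nbrs[OF vc, of w t t] by blast
    qed
    have "two_ok c' x y z"
    proof (rule nonexceptional[OF c'(1)])
      show "\<not> exceptional c1 c'' x y z" using x(1) by (simp add: exceptional_def)
      show "\<not> exceptional c1 c'' y x z" using no[of y] by (auto simp: exceptional_def)
      show "\<not> exceptional c1 c'' z x y" using no[of z] by (auto simp: exceptional_def)
    qed
    then show ?thesis using c'(2) unfolding two_ok_def pair_ok_def by blast
  qed
  have c2: "adj c2 y \<and> adj c2 z"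
    using c[OF codegree_3_perm(1)[OF s]] sym ex by blast
  have c3: "adj c3 y \<and> adj c3 z"
    using c[OF codegree_3_perm(1)[OF codegree_3_perm(2)[OF s]]] sym ex by blast
  have s': "codegree_3 v x c1 y z w c2 c3"
    unfolding codegree_3_def using N d x sym ex by auto
  \<comment> \<open>By \<open>exceptional_nbrs\<close> an exceptional case here would make
    \<open>w\<close>, \<open>c2\<close>, \<open>c3\<close> a triangle, but \<open>c2\<close> and
    \<open>c3\<close> are not adjacent.\<close>
  have ne: "\<not> exceptional p q u u' u''"
    if "codegree_3 v x c1 p q u u' u''" "{u, u', u''} = {w, c2, c3}" for p q u u' u''
  proof
    assume e': "exceptional p q u u' u''"
    then have "adj u' u''" by (simp add: exceptional_def)
    moreover have "adj u u'" "adj u u''" using exceptional_nbrs[OF that(1) e'] by auto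
    ultimately have "adj a b" if "a \<in> {u, u', u''}" "b \<in> {u, u', u''}" "a \<noteq> b" for a b
      using that adj_sym by blast
    then have "adj c2 c3" using that(2) d by auto
    then show False using ex by blast
  qed
  have "two_ok c1 w c2 c3"
    using nonexceptional[OF s'] ne[OF s'] ne[OF codegree_3_perm(3)[OF s']]
      ne[OF codegree_3_perm(3)[OF codegree_3_perm(4)[OF s']]] by (simp add: insert_commute)
  then have "adj c1 c2 \<and> adj c1 c3" using ex(4) unfolding two_ok_def pair_ok_def by blast
  then show ?thesis using x ex c2 c3 s' by blast
qed

section \<open>Common neighbours that miss a private neighbour\<close>

lemma indep_same_miss:
  assumes s: "codegree_3 v w c1 c2 c3 d e f"
    and C: "\<not> adj c1 c2" "\<not> adj c1 c3" "\<not> adj c2 c3"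
    and m: "misses c1 d e f" "misses c2 d e f"
  shows False
proof -
  have N: "nbrs v = {w, c1, c2, c3, d, e, f}" and dist: "distinct [w, c1, c2, c3, d, e, f]"
    and wc: "adj w c1" using s by (auto simp: codegree_3_def)
  then have "adj v w" unfolding in_nbrs[symmetric] by simp
  then have "adj c1 c2 \<or> adj c1 c3 \<or> adj c1 d \<or> adj c2 c3 \<or> adj c2 d \<or> adj c3 d"
    using dist N by (intro link_indep_4[OF degree_7]) auto
  then have c3d: "adj c3 d" using C m by (auto simp: misses_def)
  have c2e: "adj c2 e" using m by (simp add: misses_def)
  \<comment> \<open>The matching takes \<open>c3 d\<close>, the only edge among \<open>c1\<close>,
    \<open>c2\<close>, \<open>c3\<close>, \<open>d\<close>, so these four become independent in
    \<open>J\<close>.\<close>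
  have md: "distinct [w, c1, c2, e, c3, d]" "{w, c1, c2, e, c3, d} \<subseteq> {w, c1, c2, c3, d, e, f}"
    using dist by auto
  obtain J where J: "link_graph v J" "\<not> J w c1" "\<not> J c2 e" "\<not> J c3 d"
    "\<And>p q r s. distinct [p, q, r, s] \<Longrightarrow> {p, q, r, s} \<subseteq> {w, c1, c2, c3, d, e, f} \<Longrightarrow>
      J p q \<or> J p r \<or> J p s \<or> J q r \<or> J q s \<or> J r s"
    using codegree_3_link[OF s md wc c2e c3d] by blast
  have "\<not> J c1 d" "\<not> J c2 d" "\<not> J c1 c2" "\<not> J c1 c3" "\<not> J c2 c3"
    using C m link_graphD(1)[OF J(1)] unfolding misses_def by blast+
  then show False using J(5)[of c1 c2 c3 d] J(4) dist by auto
qed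

text \<open>By \<open>indep_same_miss\<close>, \<open>c3\<close> sees both \<open>d\<close> and
  \<open>e\<close>. Matching \<open>c1\<close> to \<open>e\<close> and \<open>c2\<close> to
  \<open>d\<close> leaves \<open>c3 d\<close>, \<open>c3 e\<close> and \<open>de\<close> as the only
  possible edge of \<open>J\<close> in one quadruple each; together they form a triangle.\<close>

lemma indep_diff_miss:
  assumes s: "codegree_3 v w c1 c2 c3 d e f"
    and C: "\<not> adj c1 c2" "\<not> adj c1 c3" "\<not> adj c2 c3"
    and m: "misses c1 d e f" "misses c2 e d f" and c3: "two_ok c3 d e f"
  shows False
proof -
  have dist: "distinct [w, c1, c2, c3, d, e, f]"
    and wc: "adj w c3" using s by (auto simp: codegree_3_def)
  have C': "\<not> adj c2 c1" "\<not> adj c3 c1" "\<not> adj c3 c2" using C adj_sym by blast+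
  have c3d: "adj c3 d"
  proof (rule ccontr)
    assume "\<not> adj c3 d"
    then have "misses c3 d e f" using c3 m unfolding two_ok_def pair_ok_def misses_def by blast
    then show False using indep_same_miss[OF codegree_3_perm(2)[OF s]] C C' m by blast
  qed
  have c3e: "adj c3 e"
  proof (rule ccontr)
    assume "\<not> adj c3 e"
    then have "misses c3 e d f" using c3 m unfolding two_ok_def pair_ok_def misses_def by blast
    then show False
      using indep_same_miss[OF codegree_3_perm(2)[OF codegree_3_perm(1)[OF codegree_3_perm(3)[OF s]]]] C C' m by blast
  qed
  have c: "adj c1 e" "adj c2 d" using m by (auto simp: misses_def)
  have md: "distinct [w, c3, c1, e, c2, d]" "{w, c3, c1, e, c2, d} \<subseteq> {w, c1, c2, c3, d, e, f}"
    using dist by auto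
  obtain J where J: "link_graph v J" "\<not> J w c3" "\<not> J c1 e" "\<not> J c2 d"
    "\<And>p q r s. distinct [p, q, r, s] \<Longrightarrow> {p, q, r, s} \<subseteq> {w, c1, c2, c3, d, e, f} \<Longrightarrow>
      J p q \<or> J p r \<or> J p s \<or> J q r \<or> J q s \<or> J r s"
    using codegree_3_link[OF s md wc c] by blast
  have nJ: "\<not> J c1 d" "\<not> J c2 e" "\<not> J c1 c2" "\<not> J c1 c3" "\<not> J c2 c3"
    using C m link_graphD(1)[OF J(1)] unfolding misses_def by blast+
  have "J c3 d" "J c3 e" "J d e"
    using J(5)[of c1 c2 c3 d] J(5)[of c1 c2 c3 e] J(5)[of c1 c2 d e] J(3,4) nJ dist by auto
  then show False using link_graphD(4)[OF J(1)] by blast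
qed

text \<open>The case in which \<open>c2 c3\<close> is the only edge among the common neighbours.
  Matching it away makes \<open>c1\<close>, \<open>c2\<close>, \<open>c3\<close>, \<open>d\<close>
  independent in \<open>J\<close>; \<open>edge_miss_23\<close> uses the same four vertices and
  matches \<open>c1 d\<close> as well.\<close>

lemma edge_same_miss:
  assumes s: "codegree_3 v w c1 c2 c3 d e f" and C: "\<not> adj c1 c2" "\<not> adj c1 c3" "adj c2 c3"
    and m: "misses c1 d e f" "misses c2 d e f" "misses c3 d e f"
  shows False
proof -
  have dist: "distinct [w, c1, c2, c3, d, e, f]" and wc: "adj w c1"
    using s by (auto simp: codegree_3_def)
  have de: "adj d e" using m by (simp add: misses_def)
  have md: "distinct [w, c1, c2, c3, d, e]" "{w, c1, c2, c3, d, e} \<subseteq> {w, c1, c2, c3, d, e, f}"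
    using dist by auto
  obtain J where J: "link_graph v J" "\<not> J w c1" "\<not> J c2 c3" "\<not> J d e"
    "\<And>p q r s. distinct [p, q, r, s] \<Longrightarrow> {p, q, r, s} \<subseteq> {w, c1, c2, c3, d, e, f} \<Longrightarrow>
      J p q \<or> J p r \<or> J p s \<or> J q r \<or> J q s \<or> J r s"
    using codegree_3_link[OF s md wc C(3) de] by blast
  have "\<not> J c1 d" "\<not> J c2 d" "\<not> J c3 d" "\<not> J c1 c2" "\<not> J c1 c3"
    using C m link_graphD(1)[OF J(1)] unfolding misses_def by blast+
  then show False using J(5)[of c1 c2 c3 d] J(3) dist by auto
qed

lemma edge_miss_23:
  assumes s: "codegree_3 v w c1 c2 c3 d e f" and C: "\<not> adj c1 c2" "\<not> adj c1 c3" "adj c2 c3"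
    and m: "misses c1 e d f" "misses c2 d e f" "misses c3 d e f"
  shows False
proof -
  have dist: "distinct [w, c1, c2, c3, d, e, f]" using s by (auto simp: codegree_3_def)
  have c: "adj c1 d" "adj e f" using m by (auto simp: misses_def)
  have md: "distinct [c1, d, c2, c3, e, f]" "{c1, d, c2, c3, e, f} \<subseteq> {w, c1, c2, c3, d, e, f}"
    using dist by auto
  obtain J where J: "link_graph v J" "\<not> J c1 d" "\<not> J c2 c3" "\<not> J e f"
    "\<And>p q r s. distinct [p, q, r, s] \<Longrightarrow> {p, q, r, s} \<subseteq> {w, c1, c2, c3, d, e, f} \<Longrightarrow>
      J p q \<or> J p r \<or> J p s \<or> J q r \<or> J q s \<or> J r s"
    using codegree_3_link[OF s md c(1) C(3) c(2)] by blast
  have "\<not> J c2 d" "\<not> J c3 d" "\<not> J c1 c2" "\<not> J c1 c3"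
    using C m link_graphD(1)[OF J(1)] unfolding misses_def by blast+
  then show False using J(5)[of c1 c2 c3 d] J(2,3) dist by auto
qed

text \<open>No quadruple becomes independent here. Instead three quadruples keep one possible edge
  each, and these edges form the triangle \<open>w c2 c3\<close>.\<close>

lemma edge_miss_12:
  assumes s: "codegree_3 v w c1 c2 c3 d e f" and C: "\<not> adj c1 c2" "\<not> adj c1 c3" "adj c2 c3"
    and m: "misses c1 d e f" "misses c2 d e f" "misses c3 e d f"
  shows False
proof -
  have dist: "distinct [w, c1, c2, c3, d, e, f]" and wc: "adj w c1" and w: "\<not> adj w d"
    using s by (auto simp: codegree_3_def)
  have c: "adj c2 e" "adj c3 d" using m by (auto simp: misses_def)
  have md: "distinct [w, c1, c2, e, c3, d]" "{w, c1, c2, e, c3, d} \<subseteq> {w, c1, c2, c3, d, e, f}"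
    using dist by auto
  obtain J where J: "link_graph v J" "\<not> J w c1" "\<not> J c2 e" "\<not> J c3 d"
    "\<And>p q r s. distinct [p, q, r, s] \<Longrightarrow> {p, q, r, s} \<subseteq> {w, c1, c2, c3, d, e, f} \<Longrightarrow>
      J p q \<or> J p r \<or> J p s \<or> J q r \<or> J q s \<or> J r s"
    using codegree_3_link[OF s md wc c] by blast
  have nJ: "\<not> J w d" "\<not> J c1 d" "\<not> J c2 d" "\<not> J c1 c2" "\<not> J c1 c3"
    using C m w link_graphD(1)[OF J(1)] unfolding misses_def by blast+
  have "J w c2" "J w c3" "J c2 c3"
    using J(5)[of w c1 c2 d] J(5)[of w c1 c3 d] J(5)[of c1 c2 c3 d] J(2,4) nJ dist by auto
  then show False using link_graphD(2,4)[OF J(1)] by blast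
qed

text \<open>At least one of \<open>w c2\<close>, \<open>w c3\<close>, \<open>c2 c3\<close> is absent
  from the triangle-free \<open>J\<close>. Whichever it is, independent quadruples are avoided only
  if \<open>c1 e\<close>, \<open>c1 f\<close> and \<open>ef\<close> all belong to \<open>J\<close>,
  again a triangle.\<close>

lemma edge_miss_all:
  assumes s: "codegree_3 v w c1 c2 c3 d e f" and C: "\<not> adj c1 c2" "\<not> adj c1 c3" "adj c2 c3"
    and m: "misses c1 d e f" "misses c2 e d f" "misses c3 f d e"
  shows False
proof -
  have dist: "distinct [w, c1, c2, c3, d, e, f]" and wc: "adj w c1"
    and w: "\<not> adj w d" "\<not> adj w e" "\<not> adj w f"
    using s by (auto simp: codegree_3_def)
  have c: "adj c2 f" "adj c3 e" using m by (auto simp: misses_def)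
  have md: "distinct [w, c1, c2, f, c3, e]" "{w, c1, c2, f, c3, e} \<subseteq> {w, c1, c2, c3, d, e, f}"
    using dist by auto
  obtain J where J: "link_graph v J" "\<not> J w c1" "\<not> J c2 f" "\<not> J c3 e"
    "\<And>p q r s. distinct [p, q, r, s] \<Longrightarrow> {p, q, r, s} \<subseteq> {w, c1, c2, c3, d, e, f} \<Longrightarrow>
      J p q \<or> J p r \<or> J p s \<or> J q r \<or> J q s \<or> J r s"
    using codegree_3_link[OF s md wc c] by blast
  have nJ: "\<not> J w d" "\<not> J w e" "\<not> J w f" "\<not> J c1 d" "\<not> J c2 e" "\<not> J c3 f" "\<not> J c1 c2" "\<not> J c1 c3"
    using C m w link_graphD(1)[OF J(1)] unfolding misses_def by blast+
  have "J w c2 \<or> J c2 d" "J w c3 \<or> J c3 d" "J c1 e \<or> J c2 c3" "J c1 f \<or> J c2 c3"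
    "J w c2 \<or> J e f" "J w c3 \<or> J e f" "J c2 c3 \<or> J e f" "J d e \<or> J c1 e" "J d f \<or> J c1 f"
    "J w c3 \<or> J c1 e" "J w c2 \<or> J c1 f" "J w c3 \<or> J c1 f" "J w c2 \<or> J c1 e"
    using J(5)[of w c1 c2 d] J(5)[of w c1 c3 d] J(5)[of c1 c2 c3 e] J(5)[of c1 c2 c3 f]
      J(5)[of w c2 e f] J(5)[of w c3 e f] J(5)[of c2 c3 e f] J(5)[of w c1 d e] J(5)[of w c1 d f]
      J(5)[of w c1 c3 e] J(5)[of w c1 c2 f] J(5)[of w c1 c3 f] J(5)[of w c1 c2 e] J(2-4) nJ dist by auto
  moreover have "\<not> (J w c2 \<and> J c2 c3 \<and> J w c3)" "\<not> (J c1 e \<and> J e f \<and> J c1 f)"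
    "\<not> (J c2 c3 \<and> J c3 d \<and> J c2 d)" "\<not> (J d e \<and> J e f \<and> J d f)"
    using link_graphD(4)[OF J(1)] by blast+
  ultimately show False by argo
qed

text \<open>Rename so that \<open>c1\<close> misses \<open>d\<close>; nine positions remain for
  \<open>c2\<close> and \<open>c3\<close>. Exchanging \<open>c2\<close> with \<open>c3\<close> or
  \<open>e\<close> with \<open>f\<close> reduces them to the four preceding lemmas.\<close>

lemma edge_misses:
  assumes s: "codegree_3 v w c1 c2 c3 x y z" and C: "\<not> adj c1 c2" "\<not> adj c1 c3" "adj c2 c3"
    and m: "misses c1 x y z \<or> misses c1 y x z \<or> misses c1 z x y"
      "misses c2 x y z \<or> misses c2 y x z \<or> misses c2 z x y"
      "misses c3 x y z \<or> misses c3 y x z \<or> misses c3 z x y"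
  shows False
proof -
  have *: False if s: "codegree_3 v w c1 c2 c3 d e f" and m1: "misses c1 d e f"
    and m2: "misses c2 d e f \<or> misses c2 e d f \<or> misses c2 f d e"
    and m3: "misses c3 d e f \<or> misses c3 e d f \<or> misses c3 f d e" for d e f
  proof -
    have C': "adj c3 c2" using C adj_sym by blast
    note p = codegree_3_perm[OF s]
    note pp = codegree_3_perm(2)[OF p(4)]
    have a: "\<not> (misses c2 d e f \<and> misses c3 d e f)" using edge_same_miss[OF s C m1] by blast
    have b: "\<not> (misses c2 d e f \<and> misses c3 e d f)" using edge_miss_12[OF s C m1] by blast
    have c: "\<not> (misses c2 d e f \<and> misses c3 f d e)"
      using edge_miss_12[OF p(4) C] m1 misses_swap by blast
    have d: "\<not> (misses c2 e d f \<and> misses c3 d e f)"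
      using edge_miss_12[OF p(2) C(2,1) C' m1] by blast
    have e: "\<not> (misses c2 f d e \<and> misses c3 d e f)"
      using edge_miss_12[OF pp C(2,1) C'] m1 misses_swap by blast
    have f: "\<not> (misses c2 e d f \<and> misses c3 e d f)"
      using edge_miss_23[OF p(3) C m1] by blast
    have g: "\<not> (misses c2 f d e \<and> misses c3 f d e)"
      using edge_miss_23[OF codegree_3_perm(3)[OF p(4)] C] m1 misses_swap by blast
    have h: "\<not> (misses c2 e d f \<and> misses c3 f d e)" using edge_miss_all[OF s C m1] by blast
    have i: "\<not> (misses c2 f d e \<and> misses c3 e d f)"
      using edge_miss_all[OF p(4) C] m1 misses_swap by blast
    show False using m2 m3 a b c d e f g h i by blast
  qed
  have s2: "codegree_3 v w c1 c2 c3 y x z" and s3: "codegree_3 v w c1 c2 c3 z x y"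
    using s unfolding codegree_3_def by auto
  show False
    using m(1)
  proof (elim disjE)
    assume "misses c1 x y z" from *[OF s this m(2,3)] show False .
  next
    assume "misses c1 y x z" from *[OF s2 this] m(2,3) misses_swap show False by blast
  next
    assume "misses c1 z x y" from *[OF s3 this] m(2,3) misses_swap show False by blast
  qed
qed

text \<open>Consequently, among independent common neighbours at most one fails to see all private
  neighbours of \<open>v\<close>.\<close>

lemma indep_misses:
  assumes s: "codegree_3 v w c1 c2 c3 x y z" and C: "\<not> adj c1 c2" "\<not> adj c1 c3" "\<not> adj c2 c3"
    and t: "two_ok c1 x y z" "two_ok c2 x y z" "two_ok c3 x y z"
    and n: "\<not> (adj c1 x \<and> adj c1 y \<and> adj c1 z)" "\<not> (adj c2 x \<and> adj c2 y \<and> adj c2 z)"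
  shows False
proof -
  have *: False if s: "codegree_3 v w c1 c2 c3 d e f" and m1: "misses c1 d e f"
    and m2: "misses c2 d e f \<or> misses c2 e d f \<or> misses c2 f d e" and t3: "two_ok c3 d e f" for d e f
    using m2
  proof (elim disjE)
    assume "misses c2 d e f" from indep_same_miss[OF s C m1 this] show False .
  next
    assume "misses c2 e d f" from indep_diff_miss[OF s C m1 this t3] show False .
  next
    assume "misses c2 f d e"
    from indep_diff_miss[OF codegree_3_perm(4)[OF s] C _ this two_ok_swap(2)[OF t3]] m1 misses_swap
    show False by blast
  qed
  have s2: "codegree_3 v w c1 c2 c3 y x z" and s3: "codegree_3 v w c1 c2 c3 z x y"
    using s unfolding codegree_3_def by auto
  have t3: "two_ok c3 y x z" "two_ok c3 z x y"
    using two_ok_swap(1)[OF t(3)] two_ok_swap(1)[OF two_ok_swap(2)[OF t(3)]] by blast+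
  note m2 = two_ok_misses[OF t(2) n(2)]
  show False
    using two_ok_misses[OF t(1) n(1)]
  proof (elim disjE)
    assume "misses c1 x y z" from *[OF s this m2 t(3)] show False .
  next
    assume "misses c1 y x z" from *[OF s2 this _ t3(1)] m2 misses_swap show False by blast
  next
    assume "misses c1 z x y" from *[OF s3 this _ t3(2)] m2 misses_swap show False by blast
  qed
qed

section \<open>Both ends of an edge in exactly three triangles\<close>

lemma two_ok_distinct_nbrs:
  assumes "two_ok c x y z" "distinct [x, y, z]"
  obtains p q where "p \<noteq> q" "{p, q} \<subseteq> {x, y, z}" "adj c p" "adj c q"
  using assms unfolding two_ok_def pair_ok_def by auto

lemma codegree_3_other_side:
  assumes s: "codegree_3 v w c1 c2 c3 x y z"
  obtains p q r where "codegree_3 w v c1 c2 c3 p q r"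
    "distinct [v, w, c1, c2, c3, x, y, z, p, q, r]"
proof -
  have N: "nbrs v = {w, c1, c2, c3, x, y, z}" and d: "distinct [w, c1, c2, c3, x, y, z]"
    and w: "\<not> adj w x" "\<not> adj w y" "\<not> adj w z" and wc: "adj w c1" "adj w c2" "adj w c3"
    using s by (auto simp: codegree_3_def)
  have v: "adj v w" "adj v c1" "adj v c2" "adj v c3" "adj v x" "adj v y" "adj v z"
    unfolding in_nbrs[symmetric] N by simp_all
  have wv: "adj w v" using v(1) adj_sym by blast
  have vne: "v \<notin> {w, c1, c2, c3, x, y, z}" using v adj_neq by blast
  have "{v, c1, c2, c3} \<subseteq> nbrs w" using wv wc by simp
  moreover have "card {v, c1, c2, c3} = 4" using d vne by auto
  ultimately have "card (nbrs w - {v, c1, c2, c3}) = 3"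
    using degree_7[OF wv] by (simp add: card_Diff_subset)
  then obtain p q r where pqr: "nbrs w - {v, c1, c2, c3} = {p, q, r}" "p \<noteq> q" "p \<noteq> r" "q \<noteq> r"
    by (auto simp: card_3_iff)
  have in_w: "p \<in> nbrs w - {v, c1, c2, c3}" "q \<in> nbrs w - {v, c1, c2, c3}" "r \<in> nbrs w - {v, c1, c2, c3}"
    unfolding pqr by simp_all
  have nv: "t \<noteq> w \<and> t \<noteq> x \<and> t \<noteq> y \<and> t \<noteq> z" if "t \<in> nbrs w" for t
    using that w adj_irrefl by auto
  have dist: "distinct [v, w, c1, c2, c3, x, y, z, p, q, r]"
    using d vne pqr(2-4) in_w nv[of p] nv[of q] nv[of r] by auto
  have Nw: "nbrs w = {v, c1, c2, c3, p, q, r}" using pqr(1) \<open>{v, c1, c2, c3} \<subseteq> nbrs w\<close> by blast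
  have no: "\<not> adj v t" if "t \<in> {p, q, r}" for t
  proof
    assume "adj v t"
    then have "t \<in> {w, c1, c2, c3, x, y, z}" unfolding in_nbrs[symmetric] N .
    then show False using that dist by auto
  qed
  have "codegree_3 w v c1 c2 c3 p q r"
    unfolding codegree_3_def using Nw dist v no by simp
  then show thesis using that dist by blast
qed

text \<open>Pass to the edge \<open>vx\<close>, whose common neighbours are \<open>c1\<close>,
  \<open>y\<close>, \<open>z\<close>, and to its end \<open>x\<close>. Each of the three already has
  five neighbours outside \<open>{p, q, r}\<close>, so each misses one of \<open>p\<close>,
  \<open>q\<close>, \<open>r\<close>; and \<open>c1\<close>, which sees two of them, is full and
  hence joined to neither \<open>y\<close> nor \<open>z\<close>. So \<open>yz\<close> is the only
  edge among the three, against \<open>edge_misses\<close>.\<close>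

lemma not_exceptional:
  assumes s: "codegree_3 v w c1 c2 c3 x y z"
  shows "\<not> exceptional c2 c3 x y z"
proof
  assume e: "exceptional c2 c3 x y z"
  note st = exceptional_structure[OF s e]
  then have s': "codegree_3 v x c1 y z w c2 c3" by blast
  obtain p q r where t: "codegree_3 x v c1 y z p q r"
    and d: "distinct [v, x, c1, y, z, w, c2, c3, p, q, r]"
    by (rule codegree_3_other_side[OF s'])
  have wc: "adj w c1" and N: "nbrs v = {w, c1, c2, c3, x, y, z}" using s by (auto simp: codegree_3_def)
  have v: "adj v c1" "adj v y" "adj v z" unfolding in_nbrs[symmetric] N by simp_all
  have c1: "adj c1 v" "adj c1 x" "adj c1 w" "adj c1 c2" "adj c1 c3"
    and y: "adj y v" "adj y x" "adj y z" "adj y c2" "adj y c3"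
    and z: "adj z v" "adj z x" "adj z y" "adj z c2" "adj z c3"
    using st wc v adj_sym by blast+
  have pqr: "distinct [p, q, r]" using d by simp
  have c1_8: False if "u \<in> {y, z}" "adj c1 u" "a \<noteq> b" "{a, b} \<subseteq> {p, q, r}" "adj c1 a" "adj c1 b" for u a b
    by (rule eight_nbrs[of v x w c2 c3 u a b c1]) (use that c1 d in auto)
  \<comment> \<open>An exceptional case at \<open>m\<close> would join \<open>m\<close> to
    \<open>c1\<close> and give \<open>c1\<close> two neighbours in \<open>{p, q, r}\<close>: eight
    neighbours in all.\<close>
  have centre: False if t': "codegree_3 x v m c1 n u u' u''" "{u, u', u''} = {p, q, r}" "m \<in> {y, z}"
    and e': "exceptional c1 n u u' u''" for m n u u' u''
  proof -
    have "adj m c1" "adj c1 u'" "adj c1 u''" using exceptional_structure[OF t'(1) e'] by auto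
    moreover have "u' \<noteq> u''" using t'(1) by (auto simp: codegree_3_def)
    ultimately show False using c1_8[of m u' u''] t'(2,3) adj_sym by blast
  qed
  have t_perm: "codegree_3 x v c1 y z q p r" "codegree_3 x v c1 y z r p q"
    "codegree_3 x v y c1 z p q r" "codegree_3 x v y c1 z q p r" "codegree_3 x v y c1 z r p q"
    "codegree_3 x v z c1 y p q r" "codegree_3 x v z c1 y q p r" "codegree_3 x v z c1 y r p q"
    using t unfolding codegree_3_def by auto
  have "two_ok c1 p q r"
    by (rule nonexceptional[OF t]) (use y(3) in \<open>auto simp: exceptional_def\<close>)
  then obtain a b where ab: "a \<noteq> b" "{a, b} \<subseteq> {p, q, r}" "adj c1 a" "adj c1 b"
    by (rule two_ok_distinct_nbrs[OF _ pqr])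
  have ny: "\<not> adj c1 y" "\<not> adj c1 z" using c1_8[OF _ _ ab] by blast+
  have ty: "two_ok y p q r"
    by (rule nonexceptional[OF t_perm(3)])
      (use centre[OF t_perm(3)] centre[OF t_perm(4)] centre[OF t_perm(5)] in \<open>auto simp: insert_commute\<close>)
  have tz: "two_ok z p q r"
    by (rule nonexceptional[OF t_perm(6)])
      (use centre[OF t_perm(6)] centre[OF t_perm(7)] centre[OF t_perm(8)] in \<open>auto simp: insert_commute\<close>)
  have "\<not> (adj c1 p \<and> adj c1 q \<and> adj c1 r)"
    using eight_nbrs[of v x w c2 c3 p q r c1] c1 d by auto
  from two_ok_misses[OF \<open>two_ok c1 p q r\<close> this]
  have m1: "misses c1 p q r \<or> misses c1 q p r \<or> misses c1 r p q" .
  have "\<not> (adj y p \<and> adj y q \<and> adj y r)"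
    using eight_nbrs[of v x z c2 c3 p q r y] y d by auto
  from two_ok_misses[OF ty this] have m2: "misses y p q r \<or> misses y q p r \<or> misses y r p q" .
  have "\<not> (adj z p \<and> adj z q \<and> adj z r)"
    using eight_nbrs[of v x y c2 c3 p q r z] z d by auto
  from two_ok_misses[OF tz this] have m3: "misses z p q r \<or> misses z q p r \<or> misses z r p q" .
  show False by (rule edge_misses[OF t ny y(3) m1 m2 m3])
qed

lemma codegree_3_two_ok:
  assumes s: "codegree_3 v w c1 c2 c3 x y z"
  shows "two_ok c1 x y z \<and> two_ok c2 x y z \<and> two_ok c3 x y z"
proof -
  have *: "two_ok c x y z" if "codegree_3 v w c c' c'' x y z" for c c' c''
  proof (rule nonexceptional[OF that])
    show "\<not> exceptional c' c'' x y z" using not_exceptional[OF that] .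
    show "\<not> exceptional c' c'' y x z" using not_exceptional[OF codegree_3_perm(3)[OF that]] .
    have "codegree_3 v w c c' c'' z x y" using that unfolding codegree_3_def by auto
    then show "\<not> exceptional c' c'' z x y" by (rule not_exceptional)
  qed
  have "codegree_3 v w c2 c1 c3 x y z" "codegree_3 v w c3 c1 c2 x y z"
    using s unfolding codegree_3_def by auto
  then show ?thesis using * s by blast
qed

text \<open>\<open>v\<close>, \<open>w\<close> and two private neighbours of either end fill six of
  the seven places at each common neighbour. An edge \<open>c2 c3\<close> takes the last place at
  both its ends, so these miss someone at both ends of \<open>vw\<close>, and \<open>c1\<close>
  misses someone at one of them, against \<open>edge_misses\<close>. Without such edges, at either
  end at least two of the three common neighbours see all private neighbours; one of them does so at
  both ends and has eight neighbours.\<close>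

lemma codegree_3_impossible: "\<not> codegree_3 v w c1 c2 c3 x y z"
proof
  assume s: "codegree_3 v w c1 c2 c3 x y z"
  define both where "both c1 c2 c3 x y z p q r \<longleftrightarrow> codegree_3 v w c1 c2 c3 x y z \<and>
    codegree_3 w v c1 c2 c3 p q r \<and> distinct [v, w, c1, c2, c3, x, y, z, p, q, r]" for c1 c2 c3 x y z p q r
  obtain p q r where b: "both c1 c2 c3 x y z p q r"
    using codegree_3_other_side[OF s] s unfolding both_def by blast
  have perm: "both c2 c1 c3 x y z p q r" "both c1 c3 c2 x y z p q r"
    if "both c1 c2 c3 x y z p q r" for c1 c2 c3
    using that codegree_3_perm(1,2)[of v w c1 c2 c3 x y z] codegree_3_perm(1,2)[of w v c1 c2 c3 p q r]
    unfolding both_def by auto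
  have all: "\<not> (adj c1 c2 \<and> adj c1 c3)"
    "adj c1 c2 \<Longrightarrow> \<not> (adj c1 x \<and> adj c1 y \<and> adj c1 z)" "adj c1 c2 \<Longrightarrow> \<not> (adj c1 p \<and> adj c1 q \<and> adj c1 r)"
    "\<not> (adj c1 x \<and> adj c1 y \<and> adj c1 z \<and> adj c1 p \<and> adj c1 q \<and> adj c1 r)"
    if b: "both c1 c2 c3 x y z p q r" for c1 c2 c3
  proof -
    have s: "codegree_3 v w c1 c2 c3 x y z" and t: "codegree_3 w v c1 c2 c3 p q r"
      and d: "distinct [v, w, c1, c2, c3, x, y, z, p, q, r]"
      using b unfolding both_def by auto
    have "adj v c1" "adj w c1" using s t by (auto simp: codegree_3_def)
    then have c: "adj c1 v" "adj c1 w" using adj_sym by blast+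
    have d3: "distinct [x, y, z]" "distinct [p, q, r]" using d by auto
    obtain e f where ef: "e \<noteq> f" "{e, f} \<subseteq> {x, y, z}" "adj c1 e" "adj c1 f"
      using two_ok_distinct_nbrs[OF conjunct1[OF codegree_3_two_ok[OF s]] d3(1)] by blast
    obtain g h where gh: "g \<noteq> h" "{g, h} \<subseteq> {p, q, r}" "adj c1 g" "adj c1 h"
      using two_ok_distinct_nbrs[OF conjunct1[OF codegree_3_two_ok[OF t]] d3(2)] by blast
    have "distinct [v, w, c2, c3, e, f, g, h]" "distinct [v, w, c2, x, y, z, g, h]"
      "distinct [v, w, c2, e, f, p, q, r]" "distinct [v, w, x, y, z, p, q, r]"
      using ef gh d by auto
    note eight = this[THEN eight_nbrs, of c1]
    show "\<not> (adj c1 c2 \<and> adj c1 c3)" "adj c1 c2 \<Longrightarrow> \<not> (adj c1 x \<and> adj c1 y \<and> adj c1 z)"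
      "adj c1 c2 \<Longrightarrow> \<not> (adj c1 p \<and> adj c1 q \<and> adj c1 r)"
      "\<not> (adj c1 x \<and> adj c1 y \<and> adj c1 z \<and> adj c1 p \<and> adj c1 q \<and> adj c1 r)"
      using eight c ef(3,4) gh(3,4) by blast+
  qed
  have edge: "\<not> adj c2 c3" if b: "both c1 c2 c3 x y z p q r" for c1 c2 c3
  proof
    assume c23: "adj c2 c3"
    then have c32: "adj c3 c2" using adj_sym by blast
    have s: "codegree_3 v w c1 c2 c3 x y z" and t: "codegree_3 w v c1 c2 c3 p q r"
      using b unfolding both_def by auto
    note b2 = perm(2)[OF perm(1)[OF b]]
    note b3 = perm(1)[OF perm(2)[OF b]]
    have b3': "both c3 c2 c1 x y z p q r" using perm(2)[OF b3] .
    have n: "\<not> adj c1 c2" "\<not> adj c1 c3"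
      using all(1)[OF b2] all(1)[OF b3'] c23 c32 adj_sym by blast+
    note ts = codegree_3_two_ok[OF s] and tt = codegree_3_two_ok[OF t]
    have m: "misses c2 x y z \<or> misses c2 y x z \<or> misses c2 z x y"
      "misses c3 x y z \<or> misses c3 y x z \<or> misses c3 z x y"
      "misses c2 p q r \<or> misses c2 q p r \<or> misses c2 r p q"
      "misses c3 p q r \<or> misses c3 q p r \<or> misses c3 r p q"
      using two_ok_misses ts tt all(2,3)[OF b2 c23] all(2,3)[OF b3' c32] by blast+
    have "\<not> (adj c1 x \<and> adj c1 y \<and> adj c1 z) \<or> \<not> (adj c1 p \<and> adj c1 q \<and> adj c1 r)"
      using all(4)[OF b] by blast
    then show False
    proof
      assume "\<not> (adj c1 x \<and> adj c1 y \<and> adj c1 z)"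
      then show False using edge_misses[OF s n c23 _ m(1,2)] two_ok_misses ts by blast
    next
      assume "\<not> (adj c1 p \<and> adj c1 q \<and> adj c1 r)"
      then show False using edge_misses[OF t n c23 _ m(3,4)] two_ok_misses tt by blast
    qed
  qed
  have pair: "(adj c1 x \<and> adj c1 y \<and> adj c1 z \<or> adj c2 x \<and> adj c2 y \<and> adj c2 z) \<and>
    (adj c1 p \<and> adj c1 q \<and> adj c1 r \<or> adj c2 p \<and> adj c2 q \<and> adj c2 r)"
    if b: "both c1 c2 c3 x y z p q r" for c1 c2 c3
  proof -
    have s: "codegree_3 v w c1 c2 c3 x y z" and t: "codegree_3 w v c1 c2 c3 p q r"
      using b unfolding both_def by auto
    have n: "\<not> adj c1 c2" "\<not> adj c1 c3" "\<not> adj c2 c3"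
      using edge[OF b] edge[OF perm(1)[OF b]] edge[OF perm(1)[OF perm(2)[OF b]]] by blast+
    show ?thesis
      using indep_misses[OF s n] indep_misses[OF t n] codegree_3_two_ok[OF s] codegree_3_two_ok[OF t] by blast
  qed
  show False
    using pair[OF b] pair[OF perm(2)[OF b]] pair[OF perm(2)[OF perm(1)[OF b]]]
      all(4)[OF b] all(4)[OF perm(1)[OF b]] all(4)[OF perm(1)[OF perm(2)[OF b]]] by blast
qed

lemma codegree_ge_4:
  assumes vw: "adj v w"
  shows "4 \<le> card (nbrs v \<inter> nbrs w)"
proof (rule ccontr)
  let ?C = "nbrs v \<inter> nbrs w"
  assume "\<not> ?thesis"
  then have "card ?C = 3" using codegree_ge_3[OF vw] by simp
  then obtain c1 c2 c3 where C: "?C = {c1, c2, c3}" "c1 \<noteq> c2" "c1 \<noteq> c3" "c2 \<noteq> c3"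
    by (auto simp: card_3_iff)
  have "w \<notin> ?C" by simp
  then have "card (insert w ?C) = 4" using \<open>card ?C = 3\<close> by simp
  moreover have "insert w ?C \<subseteq> nbrs v" using vw by auto
  ultimately have "card (nbrs v - insert w ?C) = 3"
    using degree_7[OF vw] by (simp add: card_Diff_subset)
  then obtain x y z where xyz: "nbrs v - insert w ?C = {x, y, z}" "x \<noteq> y" "x \<noteq> z" "y \<noteq> z"
    by (auto simp: card_3_iff)
  have x: "x \<in> nbrs v - insert w ?C" "y \<in> nbrs v - insert w ?C" "z \<in> nbrs v - insert w ?C"
    unfolding xyz by simp_all
  have c: "c1 \<in> ?C" "c2 \<in> ?C" "c3 \<in> ?C" unfolding C by simp_all
  have N: "nbrs v = {w, c1, c2, c3, x, y, z}"
    using xyz(1) \<open>insert w ?C \<subseteq> nbrs v\<close> unfolding C by blast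
  have "codegree_3 v w c1 c2 c3 x y z"
    unfolding codegree_3_def using N C(2-4) xyz(2-4) x c \<open>w \<notin> ?C\<close> by auto
  then show False using codegree_3_impossible by blast
qed

subsection \<open>Components of at most ten vertices\<close>

lemma handshake:
  assumes "finite A"
  shows "(\<Sum>x\<in>A. card (nbrs x \<inter> A)) = 2 * card {e \<in> E. e \<subseteq> A}"
proof -
  let ?F = "{e \<in> E. e \<subseteq> A}"
  have "card (nbrs x \<inter> A) = card {e \<in> ?F. x \<in> e}" if "x \<in> A" for x
  proof (rule bij_betw_same_card)
    show "bij_betw (\<lambda>y. {x, y}) (nbrs x \<inter> A) {e \<in> ?F. x \<in> e}"
      unfolding bij_betw_def
    proof
      show "inj_on (\<lambda>y. {x, y}) (nbrs x \<inter> A)" by (auto simp: inj_on_def doubleton_eq_iff)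
      show "(\<lambda>y. {x, y}) ` (nbrs x \<inter> A) = {e \<in> ?F. x \<in> e}"
      proof (intro set_eqI iffI)
        fix e assume e: "e \<in> {e \<in> ?F. x \<in> e}"
        then obtain y where "e = {x, y}" "adj x y" using edge_cases by blast
        then show "e \<in> (\<lambda>y. {x, y}) ` (nbrs x \<inter> A)" using e by auto
      next
        fix e assume "e \<in> (\<lambda>y. {x, y}) ` (nbrs x \<inter> A)"
        then show "e \<in> {e \<in> ?F. x \<in> e}" using that by (auto simp: adj_def)
      qed
    qed
  qed
  moreover have "(\<Sum>x\<in>A. card {e \<in> ?F. x \<in> e}) = 2 * card ?F"
  proof (rule sum_multicount)
    show "\<forall>e\<in>?F. card {x \<in> A. x \<in> e} = 2"
    proof
      fix e assume "e \<in> ?F"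
      moreover from this have "{x \<in> A. x \<in> e} = e" by auto
      ultimately show "card {x \<in> A. x \<in> e} = 2" using two_E by simp
    qed
  qed (use assms finite_E in auto)
  ultimately show ?thesis by simp
qed

lemma double_count:
  assumes "finite A" "finite B"
  shows "(\<Sum>x\<in>A. card (nbrs x \<inter> B)) = (\<Sum>y\<in>B. card (nbrs y \<inter> A))"
proof -
  have "(\<Sum>x\<in>A. card {y \<in> B. adj x y}) = (\<Sum>y\<in>B. card (nbrs y \<inter> A))"
  proof (rule sum_multicount_gen[OF assms])
    show "\<forall>y\<in>B. card {x \<in> A. adj x y} = card (nbrs y \<inter> A)"
      using adj_sym by (metis (no_types, lifting) Collect_cong Int_def in_nbrs inf_commute)
  qed
  moreover have "{y \<in> B. adj x y} = nbrs x \<inter> B" for x by auto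
  ultimately show ?thesis by simp
qed

text \<open>No triangle lies inside a cut, so the edges within \<open>P\<close> and within
  \<open>W - P\<close> serve as \<open>S\<close>. By regularity twice their number is
  \<open>7 * card W\<close> minus twice the size of the cut, and \<open>large\<close> bounds this by
  four times the number of triangles.\<close>

lemma cut_reduction:
  assumes W: "finite W" "\<And>x. x \<in> W \<Longrightarrow> nbrs x \<subseteq> W" "\<And>x. x \<in> W \<Longrightarrow> card (nbrs x) = 7"
    and P: "P \<subseteq> W"
    and large: "7 * card W \<le> 2 * (\<Sum>x\<in>P. card (nbrs x \<inter> (W - P))) + 4 * length ts"
    and ts: "ts \<noteq> []" "distinct (concat (map tri_edges ts))"
      "\<forall>(x, y, z)\<in>set ts. adj x y \<and> adj y z \<and> adj x z"
      "\<forall>(x, y, z)\<in>set ts. x \<in> W"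
  shows False
proof -
  let ?Q = "W - P"
  define F G where "F = {e \<in> E. e \<subseteq> P}" and "G = {e \<in> E. e \<subseteq> ?Q}"
  have fin: "finite P" "finite ?Q" "finite F" "finite G"
    using W(1) P finite_subset finite_E by (auto simp: F_def G_def)
  have split: "card (nbrs x \<inter> P) + card (nbrs x \<inter> ?Q) = 7" if "x \<in> W" for x
  proof -
    have "nbrs x = (nbrs x \<inter> P) \<union> (nbrs x \<inter> ?Q)" using W(2)[OF that] by blast
    then have "card (nbrs x) = card (nbrs x \<inter> P) + card (nbrs x \<inter> ?Q)"
      by (metis Diff_disjoint Int_assoc Int_left_commute card_Un_disjoint finite_Int finite_nbrs inf_bot_right)
    then show ?thesis using W(3)[OF that] by simp
  qed
  have "(\<Sum>x\<in>P. card (nbrs x \<inter> P)) + (\<Sum>x\<in>P. card (nbrs x \<inter> ?Q)) = 7 * card P"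
    unfolding sum.distrib[symmetric] using split P by (simp add: subset_iff)
  moreover have "(\<Sum>x\<in>?Q. card (nbrs x \<inter> P)) + (\<Sum>x\<in>?Q. card (nbrs x \<inter> ?Q)) = 7 * card ?Q"
    unfolding sum.distrib[symmetric] using split by simp
  moreover have "card W = card P + card ?Q"
    using P W(1) by (metis card_Diff_subset card_mono fin(1) le_add_diff_inverse)
  moreover note handshake[OF fin(1)] handshake[OF fin(2)] double_count[OF fin(1,2)]
  ultimately have "card F + card G \<le> 2 * length ts"
    using large unfolding F_def G_def by linarith
  moreover have "card (F \<union> G) \<le> card F + card G" by (rule card_Un_le)
  ultimately have card: "card (F \<union> G) \<le> 2 * length ts" by linarith
  have cov: "covered (F \<union> G) x y" if "x \<in> W" "adj x y" for x y
    unfolding covered_def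
  proof (intro allI impI)
    fix z assume "adj x z" "adj y z"
    moreover from this have "x \<in> W" "y \<in> W" "z \<in> W"
      using that W(2)[OF that(1), THEN subsetD] by auto
    ultimately show "{x, y} \<in> F \<union> G \<or> {x, z} \<in> F \<union> G \<or> {y, z} \<in> F \<union> G"
      using that(2) unfolding F_def G_def adj_def by blast
  qed
  have "\<forall>(x, y, z)\<in>set ts. covered (F \<union> G) x y \<and> covered (F \<union> G) y z \<and> covered (F \<union> G) x z"
  proof (clarify)
    fix x y z assume "(x, y, z) \<in> set ts"
    then have "adj x y" "adj y z" "adj x z" "x \<in> W" using ts(3,4) by auto
    then show "covered (F \<union> G) x y \<and> covered (F \<union> G) y z \<and> covered (F \<union> G) x z"
      using cov W(2)[of x, THEN subsetD] by auto
  qed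
  then show False
    using local_reduction_list[OF ts(1,2) card _ ts(3)] fin(3,4) by simp
qed

section \<open>Hexagons and six edge-disjoint triangles\<close>

definition gaps :: "'a \<Rightarrow> 'a \<Rightarrow> 'a \<Rightarrow> 'a \<Rightarrow> 'a \<Rightarrow> 'a \<Rightarrow> nat" where
  "gaps a b c d e f = of_bool (\<not> adj a b) + of_bool (\<not> adj b c) + of_bool (\<not> adj c d) +
    of_bool (\<not> adj d e) + of_bool (\<not> adj e f) + of_bool (\<not> adj f a)"

text \<open>The rotation argument of Dirac and Ore: a cyclic ordering with fewest gaps has none.\<close>

lemma hexagon_step:
  assumes dist: "distinct [a, b, c, d, e, f]"
    and deg: "\<And>x. x \<in> {a, b, c, d, e, f} \<Longrightarrow> 3 \<le> card (nbrs x \<inter> {a, b, c, d, e, f})"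
    and ab: "\<not> adj a b"
  obtains a' b' c' d' e' f' where "{a', b', c', d', e', f'} = {a, b, c, d, e, f}"
    "distinct [a', b', c', d', e', f']" "gaps a' b' c' d' e' f' < gaps a b c d e f"
proof -
  have three: "\<not> (nbrs x \<inter> {a, b, c, d, e, f} \<subseteq> {p, q})" if "x \<in> {a, b, c, d, e, f}" for x p q
  proof
    assume "nbrs x \<inter> {a, b, c, d, e, f} \<subseteq> {p, q}"
    then have "card (nbrs x \<inter> {a, b, c, d, e, f}) \<le> card {p, q}" by (intro card_mono) auto
    also have "\<dots> \<le> 2" by (simp add: card_insert_if)
    finally show False using deg[OF that] by simp
  qed
  have ba: "\<not> adj b a" using ab adj_sym by blast
  have A: "(adj a c \<and> adj a d) \<or> (adj a c \<and> adj a e) \<or> (adj a d \<and> adj a e)"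
  proof (rule ccontr)
    assume "\<not> ?thesis"
    then have "nbrs a \<inter> {a, b, c, d, e, f} \<subseteq> {c, f} \<or> nbrs a \<inter> {a, b, c, d, e, f} \<subseteq> {d, f} \<or>
        nbrs a \<inter> {a, b, c, d, e, f} \<subseteq> {e, f}"
      using ab adj_irrefl[of a] by auto
    then show False using three[of a] by blast
  qed
  have B: "(adj b d \<and> adj b e) \<or> (adj b d \<and> adj b f) \<or> (adj b e \<and> adj b f)"
  proof (rule ccontr)
    assume "\<not> ?thesis"
    then have "nbrs b \<inter> {a, b, c, d, e, f} \<subseteq> {c, d} \<or> nbrs b \<inter> {a, b, c, d, e, f} \<subseteq> {c, e} \<or>
        nbrs b \<inter> {a, b, c, d, e, f} \<subseteq> {c, f}"
      using ba adj_irrefl[of b] by auto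
    then show False using three[of b] by blast
  qed
  have sym: "adj x y \<longleftrightarrow> adj y x" for x y by (rule adj_sym)
  \<comment> \<open>\<open>A\<close> and \<open>B\<close> each select two of the three consecutive
    pairs \<open>cd\<close>, \<open>de\<close>, \<open>ef\<close>, so they share one. Reversing the
    segment from \<open>b\<close> to the first vertex of that pair replaces the gap
    \<open>ab\<close> and the pair by two edges.\<close>
  consider "adj a c" "adj b d" | "adj a d" "adj b e" | "adj a e" "adj b f"
    using A B by blast
  then show thesis
  proof cases
    case 1
    have "gaps a c b d e f < gaps a b c d e f"
      using 1 ab unfolding gaps_def sym[of c b] by simp
    then show thesis using that[of a c b d e f] dist by auto
  next
    case 2
    have "gaps a d c b e f < gaps a b c d e f"
      using 2 ab unfolding gaps_def sym[of d c] sym[of c b] by simp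
    then show thesis using that[of a d c b e f] dist by auto
  next
    case 3
    have "gaps a e d c b f < gaps a b c d e f"
      using 3 ab unfolding gaps_def sym[of e d] sym[of d c] sym[of c b] by simp
    then show thesis using that[of a e d c b f] dist by auto
  qed
qed

lemma hexagon:
  assumes "card U = 6" and deg: "\<And>x. x \<in> U \<Longrightarrow> 3 \<le> card (nbrs x \<inter> U)"
  obtains a b c d e f where "U = {a, b, c, d, e, f}" "distinct [a, b, c, d, e, f]"
    "adj a b" "adj b c" "adj c d" "adj d e" "adj e f" "adj f a"
proof -
  have *: "\<exists>a b c d e f. U = {a, b, c, d, e, f} \<and> distinct [a, b, c, d, e, f] \<and>
      adj a b \<and> adj b c \<and> adj c d \<and> adj d e \<and> adj e f \<and> adj f a"
    if "U = {a, b, c, d, e, f}" "distinct [a, b, c, d, e, f]" "gaps a b c d e f = n" for n a b c d e f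
    using that
  proof (induction n arbitrary: a b c d e f rule: less_induct)
    case (less n)
    have step: ?case if U: "U = {p, q, r, s, t, u}" and d: "distinct [p, q, r, s, t, u]"
      and g: "gaps p q r s t u = n" and pq: "\<not> adj p q" for p q r s t u
    proof -
      have deg': "3 \<le> card (nbrs x \<inter> {p, q, r, s, t, u})" if "x \<in> {p, q, r, s, t, u}" for x
        using deg[of x] that unfolding U by blast
      obtain a' b' c' d' e' f' where "{a', b', c', d', e', f'} = {p, q, r, s, t, u}"
        "distinct [a', b', c', d', e', f']" "gaps a' b' c' d' e' f' < gaps p q r s t u"
        using hexagon_step[OF d deg' pq] by blast
      then show ?case using less.IH[of "gaps a' b' c' d' e' f'" a' b' c' d' e' f'] U g by simp
    qed
    \<comment> \<open>The count of gaps is invariant under rotation, so any gap can be moved to the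
      first place.\<close>
    have rot: "U = {b, c, d, e, f, a}" "U = {c, d, e, f, a, b}" "U = {d, e, f, a, b, c}"
      "U = {e, f, a, b, c, d}" "U = {f, a, b, c, d, e}"
      using less.prems(1) by auto
    have dr: "distinct [b, c, d, e, f, a]" "distinct [c, d, e, f, a, b]" "distinct [d, e, f, a, b, c]"
      "distinct [e, f, a, b, c, d]" "distinct [f, a, b, c, d, e]"
      using less.prems(2) by auto
    have gr: "gaps b c d e f a = n" "gaps c d e f a b = n" "gaps d e f a b c = n"
      "gaps e f a b c d = n" "gaps f a b c d e = n"
      using less.prems(3) unfolding gaps_def by simp_all
    show ?case
    proof (cases "adj a b \<and> adj b c \<and> adj c d \<and> adj d e \<and> adj e f \<and> adj f a")
      case True
      then show ?thesis using less.prems(1,2) by blast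
    next
      case False
      then show ?thesis
        using step[OF less.prems] step[OF rot(1) dr(1) gr(1)] step[OF rot(2) dr(2) gr(2)]
          step[OF rot(3) dr(3) gr(3)] step[OF rot(4) dr(4) gr(4)] step[OF rot(5) dr(5) gr(5)] by blast
    qed
  qed
  obtain xs where "set xs = U" "distinct xs"
    using finite_distinct_list[of U] assms(1) by (metis card.infinite zero_neq_numeral)
  then have "length xs = 6" using assms(1) distinct_card by fastforce
  then obtain a b c d e f where xs: "xs = [a, b, c, d, e, f]"
    by (auto simp: numeral_eq_Suc length_Suc_conv)
  then show thesis
    using *[of a b c d e f "gaps a b c d e f"] \<open>set xs = U\<close> \<open>distinct xs\<close> that by auto
qed

text \<open>Degree three on six vertices is Dirac's bound, so \<open>U\<close> carries a hexagon.
  Joining its edges alternately to \<open>v\<close> and to \<open>y\<close> gives six edge-disjoint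
  triangles, and 24 is four times six.\<close>

lemma two_apex_reduction:
  assumes W: "finite W" "\<And>x. x \<in> W \<Longrightarrow> nbrs x \<subseteq> W" "\<And>x. x \<in> W \<Longrightarrow> card (nbrs x) = 7"
    and vy: "v \<in> W" "y \<in> W" "v \<noteq> y"
    and U: "card U = 6" "U \<subseteq> nbrs v" "U \<subseteq> nbrs y" "\<And>x. x \<in> U \<Longrightarrow> 3 \<le> card (nbrs x \<inter> U)"
    and P: "P \<subseteq> W" and large: "7 * card W \<le> 2 * (\<Sum>x\<in>P. card (nbrs x \<inter> (W - P))) + 24"
  shows False
proof -
  obtain a b c d e f where h: "U = {a, b, c, d, e, f}" "distinct [a, b, c, d, e, f]"
    "adj a b" "adj b c" "adj c d" "adj d e" "adj e f" "adj f a"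
    by (rule hexagon[OF U(1,4)])
  have v: "adj v a" "adj v b" "adj v c" "adj v d" "adj v e" "adj v f"
    and y: "adj y a" "adj y b" "adj y c" "adj y d" "adj y e" "adj y f"
    using U(2,3) unfolding h(1) by auto
  have "v \<notin> U" "y \<notin> U" using U(2,3) adj_irrefl by auto
  then have dist: "distinct [v, y, a, b, c, d, e, f]" using h(2) vy(3) unfolding h(1) by auto
  let ?ts = "[(v, a, b), (v, c, d), (v, e, f), (y, b, c), (y, d, e), (y, f, a)]"
  have "distinct [f, e, d, c, b, a, y, v]" using dist by auto
  then have "distinct (concat (map tri_edges ?ts))"
    using dist by (simp add: tri_edges_def doubleton_eq_iff)
  then show False
    using cut_reduction[OF W P, of ?ts] large v y h(3-8) vy(1,2) by simp
qed

lemma no_edges: "\<not> adj v u"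
proof
  assume vu: "adj v u"
  define N where "N = nbrs v"
  define out where "out x = nbrs x - insert v N" for x
  define R where "R = (\<Union>x\<in>N. out x)"
  define W where "W = insert v (N \<union> R)"
  have N7: "card N = 7" and fin: "finite N" "finite R" using degree_7[OF vu] by (simp_all add: N_def R_def out_def)
  have in_N: "x \<in> N \<longleftrightarrow> adj v x" for x by (simp add: N_def)
  have v: "v \<notin> N" "v \<notin> R" by (simp_all add: N_def R_def out_def)
  have disj: "N \<inter> R = {}" by (auto simp: R_def out_def)
  have Nv: "v \<in> nbrs x" if "x \<in> N" for x using that in_N adj_sym by auto
  have codeg: "4 \<le> card (nbrs x \<inter> N)" if "x \<in> N" for x
    using codegree_ge_4[of v x] that in_N unfolding N_def by (simp add: Int_commute)
  have deg_N: "card (nbrs x) = 7" if "x \<in> N" for x using degree_7[of x v] Nv[OF that] by simp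
  \<comment> \<open>Of seven neighbours, \<open>v\<close> and at least four vertices of
    \<open>N\<close> do not count.\<close>
  have out2: "card (out x) \<le> 2" if "x \<in> N" for x
  proof -
    have eq: "out x = nbrs x - insert v (nbrs x \<inter> N)" by (auto simp: out_def)
    have "card (insert v (nbrs x \<inter> N)) = Suc (card (nbrs x \<inter> N))" using v by simp
    then show ?thesis
      using codeg[OF that] deg_N[OF that] Nv[OF that] unfolding eq by (subst card_Diff_subset) auto
  qed
  have R_nbr: "\<exists>x\<in>N. adj x y" if "y \<in> R" for y using that by (auto simp: R_def out_def)
  \<comment> \<open>For a neighbour \<open>x\<close> of \<open>y\<close> in \<open>N\<close>, at
    least three of the four common neighbours lie in \<open>N\<close>, as \<open>out x\<close> has
    at most one element besides \<open>y\<close>; \<open>x\<close> itself is the fourth.\<close>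
  have R4: "4 \<le> card (nbrs y \<inter> N)" if y: "y \<in> R" for y
  proof -
    obtain x where x: "x \<in> N" "adj x y" using R_nbr[OF y] by blast
    have "\<not> adj y v" using y in_N adj_sym disj by blast
    then have "nbrs x \<inter> nbrs y \<subseteq> (nbrs y \<inter> N - {x}) \<union> (out x - {y})"
      by (auto simp: out_def)
    then have "card (nbrs x \<inter> nbrs y) \<le> card ((nbrs y \<inter> N - {x}) \<union> (out x - {y}))"
      using fin by (intro card_mono) (auto simp: out_def)
    also have "\<dots> \<le> card (nbrs y \<inter> N - {x}) + card (out x - {y})" by (rule card_Un_le)
    also have "card (out x - {y}) \<le> 1"
    proof -
      have "y \<in> out x" using x y v disj by (auto simp: out_def)
      then show ?thesis using out2[OF x(1)] by simp
    qed
    also have "x \<in> nbrs y \<inter> N" using x adj_sym by auto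
    then have "card (nbrs y \<inter> N - {x}) = card (nbrs y \<inter> N) - 1" by simp
    finally show ?thesis using codegree_ge_4[OF x(2)] by linarith
  qed
  have out_R: "card (nbrs x \<inter> R) \<le> 2" if "x \<in> N" for x
  proof -
    have "nbrs x \<inter> R \<subseteq> out x" using v disj by (auto simp: out_def)
    then have "card (nbrs x \<inter> R) \<le> card (out x)" by (intro card_mono) (auto simp: out_def)
    then show ?thesis using out2[OF that] by linarith
  qed
  \<comment> \<open>Edges between \<open>R\<close> and \<open>N\<close> counted from both sides: 4
    times \<open>card R\<close> is at most 14.\<close>
  have "4 * card R \<le> (\<Sum>y\<in>R. card (nbrs y \<inter> N))"
    using sum_bounded_below[of R 4 "\<lambda>y. card (nbrs y \<inter> N)"] R4 by (simp add: mult.commute)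
  also have "\<dots> = (\<Sum>x\<in>N. card (nbrs x \<inter> R))" by (rule double_count[OF fin(2,1)])
  also have "\<dots> \<le> card N * 2"
    using sum_bounded_above[of N "\<lambda>x. card (nbrs x \<inter> R)" 2] out_R by simp
  finally have R3: "card R \<le> 3" using N7 by linarith
  have deg_R: "card (nbrs y) = 7" if "y \<in> R" for y
    using R_nbr[OF that] degree_7[of y] adj_sym by blast
  \<comment> \<open>A neighbour \<open>z\<close> of \<open>y\<close> further away shares with
    \<open>y\<close> no vertex of \<open>N\<close>, hence at most 7 - 1 - 4 = 2 vertices, too few
    for an edge.\<close>
  have R_closed: "nbrs y \<subseteq> N \<union> R" if y: "y \<in> R" for y
  proof (rule ccontr)
    assume "\<not> nbrs y \<subseteq> N \<union> R"
    then obtain z where "z \<in> nbrs y" "z \<notin> N \<union> R" by blast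
    then have z: "adj y z" "z \<notin> N" "z \<notin> R" by simp_all
    have "\<not> adj y v" using y in_N adj_sym disj by blast
    then have "z \<noteq> v" using z by blast
    have "\<not> adj x z" if "x \<in> N" for x
      using that z \<open>z \<noteq> v\<close> by (auto simp: R_def out_def)
    then have "nbrs y \<inter> nbrs z \<subseteq> nbrs y - insert z (nbrs y \<inter> N)"
      using adj_sym adj_irrefl by auto
    then have "card (nbrs y \<inter> nbrs z) \<le> card (nbrs y - insert z (nbrs y \<inter> N))"
      by (intro card_mono) auto
    also have "\<dots> = card (nbrs y) - card (insert z (nbrs y \<inter> N))"
      using z by (intro card_Diff_subset) auto
    also have "card (insert z (nbrs y \<inter> N)) = Suc (card (nbrs y \<inter> N))" using z by simp
    finally show False using codegree_ge_4[OF z(1)] R4[OF y] deg_R[OF y] by linarith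
  qed
  have W: "finite W" "\<And>x. x \<in> W \<Longrightarrow> nbrs x \<subseteq> W" "\<And>x. x \<in> W \<Longrightarrow> card (nbrs x) = 7"
  proof -
    show "finite W" using fin by (simp add: W_def)
    show "nbrs x \<subseteq> W" if "x \<in> W" for x
      using that R_closed[of x] by (auto simp: W_def R_def out_def N_def)
    show "card (nbrs x) = 7" if "x \<in> W" for x
      using that deg_N deg_R degree_7[OF vu] by (auto simp: W_def)
  qed
  have "card (N \<union> R) = 7 + card R" using fin disj N7 by (simp add: card_Un_disjoint)
  then have card_W: "card W = 8 + card R" using fin v by (simp add: W_def)
  have "(\<Sum>x\<in>W. card (nbrs x \<inter> W)) = (\<Sum>x\<in>W. 7)"
    using W(2,3) by (intro sum.cong refl) (simp add: Int_absorb2)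
  then have "7 * card W = 2 * card {e \<in> E. e \<subseteq> W}"
    using handshake[OF W(1)] by simp
  then have "card R \<noteq> 1" "card R \<noteq> 3" using card_W by presburger+
  \<comment> \<open>Cuts are easier to count in the complement, which is regular of degree
    \<open>card R\<close> on \<open>W\<close>.\<close>
  define miss where "miss x = W - insert x (nbrs x)" for x
  have cut: "card (nbrs x \<inter> (W - P)) = card (W - P) - card (miss x - P)" if "x \<in> P" "P \<subseteq> W" for x P
  proof -
    have "nbrs x \<inter> (W - P) = (W - P) - (miss x - P)"
      using that W(2)[of x] by (auto simp: miss_def)
    moreover have "miss x - P \<subseteq> W - P" by (auto simp: miss_def)
    moreover have "finite (miss x - P)" using W(1) by (simp add: miss_def)
    ultimately show ?thesis by (simp add: card_Diff_subset)
  qed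
  have card_miss: "card (miss x) = card R" if "x \<in> W" for x
  proof -
    have "card (insert x (nbrs x)) = 8" using W(3)[OF that] by simp
    moreover have "insert x (nbrs x) \<subseteq> W" using that W(2)[OF that] by auto
    ultimately show ?thesis unfolding miss_def using card_W by (simp add: card_Diff_subset)
  qed
  have miss_sym: "y \<in> miss x" if "x \<in> miss y" "y \<in> W" for x y
    using that adj_sym[of x y] by (auto simp: miss_def)
  have U3: "3 \<le> card (nbrs x \<inter> (N - {p}))" if "x \<in> N - {p}" for x p
  proof -
    have "nbrs x \<inter> N \<subseteq> insert p (nbrs x \<inter> (N - {p}))" by auto
    then have "card (nbrs x \<inter> N) \<le> card (insert p (nbrs x \<inter> (N - {p})))"
      by (intro card_mono) auto
    also have "\<dots> \<le> Suc (card (nbrs x \<inter> (N - {p})))" by (simp add: card_insert_if)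
    finally show ?thesis using codeg[of x] that by simp
  qed
  have vW: "v \<in> W" and NW: "N \<subseteq> W" and RW: "R \<subseteq> W" by (auto simp: W_def)
  consider "card R = 0" | "card R = 2"
    using R3 \<open>card R \<noteq> 1\<close> \<open>card R \<noteq> 3\<close> by linarith
  then show False
  proof cases
    case 1
    then have miss: "miss x = {}" if "x \<in> W" for x
      using card_miss[OF that] W(1) by (simp add: miss_def)
    have "4 \<le> card W" using card_W by simp
    then obtain P where P: "P \<subseteq> W" "card P = 4" "finite P" by (rule obtain_subset_with_card_n)
    have "card (W - P) = 4" using card_Diff_subset[OF P(3,1)] P(2) card_W 1 by simp
    then have "(\<Sum>x\<in>P. card (nbrs x \<inter> (W - P))) = (\<Sum>x\<in>P. 4)"
      using cut[OF _ P(1)] miss P(1) by (intro sum.cong refl) auto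
    then have "7 * card W \<le> 2 * (\<Sum>x\<in>P. card (nbrs x \<inter> (W - P))) + 24" using P card_W 1 by simp
    moreover have "N - {u} \<subseteq> nbrs u"
      using miss[of u] vu NW in_N by (auto simp: miss_def)
    moreover have "card (N - {u}) = 6" "u \<in> W" using N7 vu in_N NW by auto
    moreover have "v \<noteq> u" using vu adj_neq by blast
    ultimately show False
      using two_apex_reduction[OF W vW _ _ _ _ _ U3 P(1), of u u] by (auto simp: N_def)
  next
    case 2
    then obtain y z where R: "R = {y, z}" "y \<noteq> z" by (auto simp: card_2_iff)
    have yz: "y \<in> W" "z \<in> W" "y \<noteq> v" "z \<noteq> v" "y \<notin> N" "z \<notin> N" using RW R v disj by auto
    have mv: "miss v = {y, z}"
      using R disj v by (auto simp: miss_def W_def N_def)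
    have vm: "v \<in> miss y" "v \<in> miss z" using mv miss_sym[OF _ vW] by auto
    have "card (miss y) = 2" "card (miss z) = 2" using card_miss yz 2 by auto
    then have "card (miss y - {v}) = 1" "card (miss z - {v}) = 1" using vm by simp_all
    then obtain p q where "miss y - {v} = {p}" "miss z - {v} = {q}" by (auto simp: card_1_singleton_iff)
    then have pq: "miss y = {v, p}" "miss z = {v, q}" "p \<noteq> v" "q \<noteq> v" using vm by auto
    have pqW: "p \<in> W" "q \<in> W" "p \<noteq> y" "q \<noteq> z" using pq by (auto simp: miss_def)
    \<comment> \<open>A balanced cut with at most two missing pairs has at least 23 of the 35 edges,
      so twelve remain.\<close>
    have big: False if P: "P \<subseteq> W" "card P = 5" "(\<Sum>x\<in>P. card (miss x - P)) \<le> 2" for P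
    proof -
      have "finite P" using P(1) W(1) finite_subset by blast
      then have "card (W - P) = 5" using card_Diff_subset[OF _ P(1)] P(2) card_W 2 by simp
      then have "card (nbrs x \<inter> (W - P)) + card (miss x - P) = 5" if "x \<in> P" for x
      proof -
        have "card (miss x - P) \<le> card (W - P)" using W(1) by (intro card_mono) (auto simp: miss_def)
        then show ?thesis using cut[OF that P(1)] \<open>card (W - P) = 5\<close> by simp
      qed
      then have "(\<Sum>x\<in>P. card (nbrs x \<inter> (W - P))) + (\<Sum>x\<in>P. card (miss x - P)) = 25"
        using P(2) by (simp flip: sum.distrib)
      then have large: "7 * card W \<le> 2 * (\<Sum>x\<in>P. card (nbrs x \<inter> (W - P))) + 24"
        using P(3) card_W 2 by linarith
      \<comment> \<open>The second apex is \<open>y\<close>. It has two non-neighbours and one of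
        them is \<open>v\<close>, so it sees all of \<open>N\<close> except at most one
        vertex.\<close>
      obtain s where s: "s \<in> N" "miss y \<inter> N \<subseteq> {s}"
      proof (cases "p \<in> N")
        case True
        then show thesis using that[of p] pq v by auto
      next
        case False
        then show thesis using that[of u] pq v vu in_N by auto
      qed
      have "N - {s} \<subseteq> nbrs y" using s(2) NW yz by (auto simp: miss_def)
      moreover have "card (N - {s}) = 6" using N7 s(1) by simp
      ultimately show False
        using two_apex_reduction[OF W vW yz(1) _ _ _ _ U3 P(1) large, of s] yz(3) by (auto simp: N_def)
    qed
    have m2: "card (miss x - P) \<le> 1" if "x \<in> W" "t \<in> miss x" "t \<in> P" for x t P
    proof -
      have "miss x - P \<subseteq> miss x - {t}" using that by auto
      then have "card (miss x - P) \<le> card (miss x - {t})"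
        using W(1) by (intro card_mono) (auto simp: miss_def)
      then show ?thesis using card_miss[OF that(1)] 2 that(2) by simp
    qed
    show False
    proof (cases "adj y z")
      case False
      moreover from this have "\<not> adj z y" using adj_sym by blast
      ultimately have "z \<in> miss y" "y \<in> miss z" using yz(1,2) R(2) by (auto simp: miss_def)
      then have p: "p = z" "q = y" using pq(1,2) yz(3,4) by auto
      have uN: "u \<in> N" using vu in_N by simp
      then have "u \<in> W" using NW by blast
      have um: "miss u \<subseteq> N"
      proof
        fix t assume t: "t \<in> miss u"
        have "u \<in> miss t" using miss_sym[OF t \<open>u \<in> W\<close>] .
        moreover have "u \<noteq> v" "u \<noteq> y" "u \<noteq> z" using uN v(1) yz(5,6) by auto
        ultimately have "t \<notin> {v, y, z}" using mv pq p by auto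
        then show "t \<in> N" using t by (auto simp: miss_def W_def R)
      qed
      have "card (miss u) = 2" using card_miss[OF \<open>u \<in> W\<close>] 2 by simp
      then obtain t where t: "t \<in> miss u" by fastforce
      then have t': "t \<in> N" "u \<in> miss t" "t \<noteq> u" using um miss_sym[OF t \<open>u \<in> W\<close>] by (auto simp: miss_def)
      \<comment> \<open>In the complement \<open>v\<close>, \<open>y\<close>, \<open>z\<close> form
        a triangle, which loses nothing across the cut. The two further vertices are a missing pair,
        so each loses at most one.\<close>
      let ?P = "{v, y, z, u, t}"
      have "distinct [v, y, z, u, t]" using yz(3-6) R(2) uN t' v(1) by auto
      then have "(\<Sum>x\<in>?P. card (miss x - ?P)) = card (miss v - ?P) + card (miss y - ?P) + card (miss z - ?P) +
          card (miss u - ?P) + card (miss t - ?P)" and "card ?P = 5" by simp_all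
      moreover have "card (miss v - ?P) = 0" "card (miss y - ?P) = 0" "card (miss z - ?P) = 0"
        using mv pq p by simp_all
      moreover have "card (miss u - ?P) \<le> 1" "card (miss t - ?P) \<le> 1"
        using m2[OF \<open>u \<in> W\<close> t] m2[of t u ?P] t' NW by auto
      ultimately show False using big[of ?P] vW yz \<open>u \<in> W\<close> t'(1) NW by auto
    next
      case True
      moreover from this have "adj z y" using adj_sym by blast
      ultimately have "z \<notin> miss y" "y \<notin> miss z" by (auto simp: miss_def)
      then have "p \<noteq> z" "q \<noteq> y" using pq(1,2) by auto
      then have pN: "p \<in> N" "q \<in> N" using pqW pq by (auto simp: W_def R)
      have py: "y \<in> miss p" "z \<in> miss q" using pq miss_sym[of p y] miss_sym[of q z] yz by auto
      \<comment> \<open>The complement contains the path \<open>p y v z q\<close>, which closes to a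
        4-cycle when \<open>p = q\<close>. The path loses at most one pair at each end; the 4-cycle
        loses none, and any fifth vertex loses at most two.\<close>
      show False
      proof (cases "p = q")
        case False
        let ?P = "{v, y, z, p, q}"
        have "distinct [v, y, z, p, q]" using yz R(2) pN v False by auto
        then have "(\<Sum>x\<in>?P. card (miss x - ?P)) = card (miss v - ?P) + card (miss y - ?P) + card (miss z - ?P) +
            card (miss p - ?P) + card (miss q - ?P)" and "card ?P = 5" by simp_all
        moreover have "card (miss v - ?P) = 0" "card (miss y - ?P) = 0" "card (miss z - ?P) = 0"
          using mv pq by simp_all
        moreover have "card (miss p - ?P) \<le> 1" "card (miss q - ?P) \<le> 1"
          using m2[OF pqW(1) py(1)] m2[OF pqW(2) py(2)] by auto
        ultimately show False using big[of ?P] vW yz pqW by auto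
      next
        case True
        have "card (miss p) = 2" using card_miss[OF pqW(1)] 2 by simp
        moreover have "{y, z} \<subseteq> miss p" using py True by simp
        moreover have "finite (miss p)" using W(1) by (simp add: miss_def)
        ultimately have mp: "miss p = {y, z}" using R(2) by (intro card_subset_eq[symmetric]) auto
        have "2 \<le> card (N - {p})" using N7 pN by simp
        then obtain t where t: "t \<in> N - {p}" by (auto elim: two_elements)
        let ?P = "{v, y, z, p, t}"
        have "distinct [v, y, z, p, t]" using yz R(2) pN v t by auto
        then have "(\<Sum>x\<in>?P. card (miss x - ?P)) = card (miss v - ?P) + card (miss y - ?P) + card (miss z - ?P) +
            card (miss p - ?P) + card (miss t - ?P)" and "card ?P = 5" by simp_all
        moreover have "card (miss v - ?P) = 0" "card (miss y - ?P) = 0" "card (miss z - ?P) = 0" "card (miss p - ?P) = 0"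
          using mv pq mp True by simp_all
        moreover have "card (miss t - ?P) \<le> 2"
        proof -
          have "card (miss t - ?P) \<le> card (miss t)"
            using W(1) by (intro card_mono) (auto simp: miss_def)
          then show ?thesis using card_miss[of t] t NW 2 by auto
        qed
        ultimately show False using big[of ?P] vW yz pqW t NW by auto
      qed
    qed
  qed
qed

lemma contradiction: False
proof -
  have "E \<noteq> {}"
  proof
    assume "E = {}"
    then have "triangle_transversal E {}"
      by (simp add: triangle_transversal_def triangle_free_def triangles_def)
    then have "\<tau> E \<le> card ({} :: 'a set set)" by (rule transversal_number_attained(2)[OF finite_E])
    then show False using counter by simp
  qed
  then obtain e where "e \<in> E" by blast
  moreover from this obtain x y where "e = {x, y}" using two_E by (meson card_2_iff)
  ultimately show False using no_edges[of x y] by (simp add: adj_def)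
qed

end

section \<open>Induction on the edge set\<close>

lemma tuza_finite:
  fixes E :: "'a set set"
  assumes "finite E" and "\<And>e. e \<in> E \<Longrightarrow> card e = 2" and "\<And>v. degree E v \<le> 7"
  shows "\<tau> E \<le> 2 * \<nu> E"
  using assms
proof (induction E rule: finite_psubset_induct)
  case (psubset E)
  have *: "\<tau> F \<le> 2 * \<nu> F" if F: "F \<subset> E" for F
  proof (rule psubset.IH[OF F])
    show "card e = 2" if "e \<in> F" for e using that F psubset.prems(1) by blast
    show "degree F v \<le> 7" for v
    proof -
      have "degree F v \<le> degree E v"
        unfolding degree_def using F psubset.hyps by (intro card_mono) auto
      then show ?thesis using psubset.prems(2)[of v] by linarith
    qed
  qed
  show ?case
  proof (rule ccontr)
    assume "\<not> \<tau> E \<le> 2 * \<nu> E"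
    then have "min_counterexample E"
      using psubset.hyps psubset.prems * by unfold_locales auto
    then show False by (rule min_counterexample.contradiction)
  qed
qed

theorem theorem1p3:
  fixes V :: "'a set" and E :: "'a set set"
  assumes "simple_graph V E"
    and "max_degree V E \<le> 7"
  shows "\<tau> E \<le> 2 * \<nu> E"
proof (rule tuza_finite)
  show "finite E" using assms(1) by (rule simple_graph_finite_edges)
  show "card e = 2" if "e \<in> E" for e using that assms(1) by (simp add: simple_graph_def)
  show "degree E v \<le> 7" for v
  proof (cases "v \<in> V")
    case True
    have "finite V" using assms(1) by (simp add: simple_graph_def)
    then have "degree E v \<le> max_degree V E"
      unfolding max_degree_def using True by (intro Max_ge) auto
    then show ?thesis using assms(2) by linarith
  next
    case False
    then have "{e \<in> E. v \<in> e} = {}" using assms(1) by (auto simp: simple_graph_def)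
    then show ?thesis by (simp only: degree_def card.empty)
  qed
qed

end
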